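(* Let $F$ be a field of characteristic $p\ge0$, let $q\in\Lambda(n)$ with $(q,p)=1$ and let $\lambda=\lambda(q)$. Then $\{\omega_q Q_T: T\in\Gamma(\lambda)\}$ is an $F$-basis of $\mathrm{Lie}_F(q)=\omega_qFS_n$. In particular $\dim_F\mathrm{Lie}_F(q)=\frac{n!}{q?}$, the number of permutations of $S_n$ of cycle type $\lambda$.
   Context: Permutations act on the right and are composed left to right; a permutation $\sigma\in S_n$ is identified with the word $(1)\sigma(2)\sigma\cdots(n)\sigma$, and a word whose letters are $1,\dots,n$ each once is identified with a permutation. Compositions $q=(q_1,\dots,q_k)$ of $n$; $q^+_j=q_1+\dots+q_j$; $m_i(q)$ = number of parts equal to $i$; $(q,p)=1$ means $p\nmid q_i$ for all $i$ (vacuous if $p=0$); $\lambda(q)$ is the partition obtained by rearranging $q$; $q?=\prod_i i^{m_i(q)}m_i(q)!$. $\Xi^q$ = sum of all $\sigma\in S_n$ whose descents (positions $i$ with $(i)\sigma>(i+1)\sigma$) lie in $\{q^+_1,\dots,q^+_k\}$. $\omega_m=(1-c_m)(1-c_{m-1})\cdots(1-c_2)\in FS_m$, $c_i=(i,i-1,\dots,1)$; $\sigma^{+r}$ maps $i+r\mapsto(i)\sigma+r$ for $i\le m$ and fixes the rest; $\omega^q=\omega_{q_1}^{+q^+_0}\cdots\omega_{q_k}^{+q^+_{k-1}}$, $\omega_q=\omega^q\Xi^q$. For a word $w=w_1\cdots w_m$ of distinct positive integers, $S_m$ acts by $\tau\cdot w=w_{(1)\tau}\cdots w_{(m)\tau}$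 (extended linearly), and $Q_w=\omega_m\cdot w$. For a partition $\lambda$ of $n$, $\Gamma(\lambda)$ is the set of tuples $T=(T_{n,1},\dots,T_{n,m_n(\lambda)},\dots,T_{1,1},\dots,T_{1,m_1(\lambda)})$ where each $T_{i,j}$ is a sequence of length $i$ of positive integers, all entries of all $T_{i,j}$ together are exactly $1,\dots,n$ each once, the first entry of each $T_{i,j}$ is its minimum, and $\min T_{i,1}<\min T_{i,2}<\dots<\min T_{i,m_i(\lambda)}$ for each $i$. Then $Q_T=Q_{T_{n,1}}\cdots Q_{T_{1,m_1(\lambda)}}$ (product = concatenation of words, extended bilinearly), regarded as an element of $FS_n$, and $\omega_qQ_T$ is a product in $FS_n$. *)

theory Defs
  imports Complex_Main "HOL-Library.Multiset" "HOL-Library.Function_Algebras"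
begin

text \<open>Elements of FS_n, and more generally formal F-linear combinations of words,
  are represented as functions nat list => F (coefficient of each word).
  A permutation of S_n is represented by its word (1)s (2)s ... (n)s.\<close>

type_synonym 'a comb = "nat list \<Rightarrow> 'a"

definition perms :: "nat \<Rightarrow> nat list set" where
  "perms n = {w. distinct w \<and> set w = {1..n}}"

definition delta :: "nat list \<Rightarrow> 'a::field comb" where
  "delta w = (\<lambda>u. if u = w then 1 else 0)"

text \<open>Right action, composition left to right: (i)(u v) = ((i)u)v.\<close>
definition perm_mult :: "nat list \<Rightarrow> nat list \<Rightarrow> nat list" where
  "perm_mult u v = map (\<lambda>j. v ! (j - 1)) u"

definition conv :: "nat \<Rightarrow> 'a::field comb \<Rightarrow> 'a comb \<Rightarrow> 'a comb" where
  "conv n x y = (\<lambda>w. \<Sum>u\<in>perms n. \<Sum>v\<in>perms n.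
      if perm_mult u v = w then x u * y v else 0)"

definition one :: "nat \<Rightarrow> 'a::field comb" where
  "one n = delta [1..<n+1]"

definition group_alg :: "nat \<Rightarrow> 'a::field comb set" where
  "group_alg n = {x. \<forall>w. w \<notin> perms n \<longrightarrow> x w = 0}"

definition prodl :: "nat \<Rightarrow> 'a::field comb list \<Rightarrow> 'a comb" where
  "prodl n xs = foldr (conv n) xs (one n)"

text \<open>c_i = (i, i-1, ..., 1) in S_m, as a word.\<close>
definition cyc :: "nat \<Rightarrow> nat \<Rightarrow> nat list" where
  "cyc m i = i # [1..<i] @ [i+1..<m+1]"

definition omega :: "nat \<Rightarrow> 'a::field comb" where
  "omega m = prodl m (map (\<lambda>i. one m - delta (cyc m i)) (rev [2..<m+1]))"

definition shiftw :: "nat \<Rightarrow> nat \<Rightarrow> nat list \<Rightarrow> nat list" where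
  "shiftw n r s = [1..<r+1] @ map (\<lambda>j. j + r) s @ [r + length s + 1..<n+1]"

definition shift :: "nat \<Rightarrow> nat \<Rightarrow> nat \<Rightarrow> 'a::field comb \<Rightarrow> 'a comb" where
  "shift n r m x = (\<lambda>w. \<Sum>s\<in>perms m. if shiftw n r s = w then x s else 0)"

definition composition :: "nat \<Rightarrow> nat list \<Rightarrow> bool" where
  "composition n q \<longleftrightarrow> (\<forall>i\<in>set q. 0 < i) \<and> sum_list q = n"

definition psum :: "nat list \<Rightarrow> nat \<Rightarrow> nat" where
  "psum q j = sum_list (take j q)"

definition omega_up :: "nat \<Rightarrow> nat list \<Rightarrow> 'a::field comb" where
  "omega_up n q = prodl n (map (\<lambda>j. shift n (psum q j) (q ! j) (omega (q ! j))) [0..<length q])"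

definition descents :: "nat list \<Rightarrow> nat set" where
  "descents w = {i. 1 \<le> i \<and> i < length w \<and> w ! (i - 1) > w ! i}"

definition Xi :: "nat \<Rightarrow> nat list \<Rightarrow> 'a::field comb" where
  "Xi n q = (\<lambda>w. if w \<in> perms n \<and> descents w \<subseteq> {psum q j | j. 1 \<le> j \<and> j \<le> length q}
                 then 1 else 0)"

definition omega_q :: "nat \<Rightarrow> nat list \<Rightarrow> 'a::field comb" where
  "omega_q n q = conv n (omega_up n q) (Xi n q)"

definition Lie :: "nat \<Rightarrow> nat list \<Rightarrow> 'a::field comb set" where
  "Lie n q = {conv n (omega_q n q) x | x. x \<in> group_alg n}"

definition act :: "nat \<Rightarrow> 'a::field comb \<Rightarrow> nat list \<Rightarrow> 'a comb" where
  "act m x w = (\<lambda>u. \<Sum>t\<in>perms m. if map (\<lambda>j. w ! (j - 1)) t = u then x t else 0)"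

definition Qw :: "nat list \<Rightarrow> 'a::field comb" where
  "Qw w = act (length w) (omega (length w)) w"

text \<open>Bilinear extension of concatenation of words.\<close>
definition cat :: "'a::field comb \<Rightarrow> 'a comb \<Rightarrow> 'a comb" where
  "cat x y = (\<lambda>u. \<Sum>i\<le>length u. x (take i u) * y (drop i u))"

text \<open>Q_T for T given as the list [T_{n,1}, ..., T_{1,m_1}].\<close>
definition QT :: "nat list list \<Rightarrow> 'a::field comb" where
  "QT Ts = foldr (\<lambda>w acc. cat (Qw w) acc) Ts (delta [])"

definition lam :: "nat list \<Rightarrow> nat list" where
  "lam q = rev (sort q)"

definition Gamma :: "nat \<Rightarrow> nat list \<Rightarrow> nat list list set" where
  "Gamma n la = {Ts. map length Ts = la \<and> distinct (concat Ts) \<and> set (concat Ts) = {1..n}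
      \<and> (\<forall>T\<in>set Ts. hd T = Min (set T))
      \<and> (\<forall>k. Suc k < length Ts \<longrightarrow> length (Ts ! k) = length (Ts ! Suc k)
              \<longrightarrow> hd (Ts ! k) < hd (Ts ! Suc k))}"

definition qq :: "nat list \<Rightarrow> nat" where
  "qq q = (\<Prod>i\<in>set q. i ^ count_list q i * fact (count_list q i))"

definition cycle_type :: "nat list \<Rightarrow> nat multiset" where
  "cycle_type w = image_mset card (mset_set
     ((\<lambda>i. {((\<lambda>j. w ! (j - 1)) ^^ k) i | k. True}) ` {1..length w}))"

definition scl :: "'a::field \<Rightarrow> 'a comb \<Rightarrow> 'a comb" where
  "scl c x = (\<lambda>u. c * x u)"

end

theory Submission
  imports Defs "HOL-Combinatorics.Cycles" "HOL-Combinatorics.Multiset_Permutations"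
    "HOL-Library.Disjoint_Sets" "HOL-Library.Product_Lexorder" "HOL-Library.Sublist"
begin

text \<open>
  Acting on a word \<open>w\<close>, \<open>\<Xi>\<^sup>q\<close> splits \<open>w\<close> in all ways into subwords of lengths \<open>q\<^sub>1, \<dots>, q\<^sub>k\<close>
  and \<open>\<omega>\<^sup>q\<close> replaces each subword by its left-normed bracket; so \<open>\<omega>\<^sub>q\<close> is the convolution product
  of the homogeneous Dynkin operators with respect to the unshuffle coproduct. Lie elements are
  primitive for that coproduct. Hence, applying \<open>\<omega>\<^sub>q\<close> to a product of \<open>k\<close> brackets, only the terms that
  distribute the factors bijectively to the \<open>k\<close> slots survive, and by the Dynkin--Specht--Wever
  identity the result is \<open>q\<^sub>1 \<cdots> q\<^sub>k\<close> times the sum of the products of these brackets over all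
  orders in which their lengths are \<open>q\<close>. The scalar is invertible since \<open>p\<close> divides no \<open>q\<^sub>i\<close>.

  Brackets starting with their smallest letter are dual to words starting with their smallest
  letter, so the symmetrised products of such brackets are independent. They also span: the subwords
  into which \<open>w\<close> is split can be grouped into symmetrised products, each of which is, up to the
  scalar, the image under \<open>\<omega>\<^sub>q\<close> of a product of brackets, and every bracket is a combination of
  brackets starting with their smallest letter. Writing the cycles of a permutation from their
  minima identifies the index set with the permutations of cycle type \<open>\<lambda>(q)\<close>.
\<close>

section \<open>Formal combinations of words\<close>

interpretation comb: vector_space "scl :: 'a::field \<Rightarrow> 'a comb \<Rightarrow> 'a comb"
  by unfold_locales (auto simp: scl_def algebra_simps fun_eq_iff)

abbreviation comb_linear :: "('a::field comb \<Rightarrow> 'a comb) \<Rightarrow> bool" where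
  "comb_linear \<equiv> module_hom scl scl"

lemma comb_linearI:
  assumes "\<And>x y. f (x + y) = f x + f y" "\<And>c x. f (scl c x) = scl c (f x)"
  shows "comb_linear f"
  unfolding module_hom_iff using assms comb.module_axioms by blast

lemma scl_apply [simp]: "scl c x w = c * x w"
  by (simp add: scl_def)

lemma sum_comb_apply: "(\<Sum>i\<in>I. f i :: 'a::field comb) w = (\<Sum>i\<in>I. f i w)"
  by (induction I rule: infinite_finite_induct) simp_all

lemma delta_apply_same [simp]: "delta w w = 1"
  by (simp add: delta_def)

lemma delta_apply_neq [simp]: "u \<noteq> w \<Longrightarrow> delta w u = 0"
  by (simp add: delta_def)

lemma comb_eq_sum_delta:
  assumes "finite S" "\<And>w. x w \<noteq> 0 \<Longrightarrow> w \<in> S"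
  shows "x = (\<Sum>w\<in>S. scl (x w) (delta w) :: 'a::field comb)"
proof
  fix u
  have "(\<Sum>w\<in>S. x w * delta w u) = (\<Sum>w\<in>S. if u = w then x w else 0)"
    by (intro sum.cong refl) (simp add: delta_def)
  then show "x u = (\<Sum>w\<in>S. scl (x w) (delta w)) u"
    using assms by (auto simp: sum_comb_apply sum.delta')
qed

subsection \<open>Linear extension\<close>

definition finite_support :: "'a::field comb \<Rightarrow> bool" where
  "finite_support x \<longleftrightarrow> finite {w. x w \<noteq> 0}"

definition lin_ext :: "(nat list \<Rightarrow> 'a::field comb) \<Rightarrow> 'a comb \<Rightarrow> 'a comb" where
  "lin_ext f x = (\<Sum>w | x w \<noteq> 0. scl (x w) (f w))"

lemma finite_support_delta [simp]: "finite_support (delta w)"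
  by (simp add: finite_support_def delta_def)

lemma finite_support_sum:
  assumes "\<And>i. i \<in> I \<Longrightarrow> finite_support (f i)"
  shows "finite_support (\<Sum>i\<in>I. f i :: 'a::field comb)"
proof (cases "finite I")
  case True
  have "{w. (\<Sum>i\<in>I. f i) w \<noteq> 0} \<subseteq> (\<Union>i\<in>I. {w. f i w \<noteq> 0})"
    by (auto simp: sum_comb_apply dest: sum.not_neutral_contains_not_neutral)
  then show ?thesis
    using True assms finite_subset unfolding finite_support_def by blast
qed (simp add: finite_support_def)

lemma finite_support_scl [simp]: "finite_support x \<Longrightarrow> finite_support (scl c x)"
  unfolding finite_support_def by (rule rev_finite_subset) auto

lemma lin_ext_superset:
  assumes "finite S" "\<And>w. x w \<noteq> 0 \<Longrightarrow> w \<in> S"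
  shows "lin_ext f x = (\<Sum>w\<in>S. scl (x w) (f w))"
  unfolding lin_ext_def by (rule sum.mono_neutral_left) (use assms in auto)

lemma lin_ext_cong:
  assumes "\<And>w. x w \<noteq> 0 \<Longrightarrow> f w = g w"
  shows "lin_ext f x = lin_ext g x"
  unfolding lin_ext_def by (rule sum.cong) (use assms in auto)

lemma lin_ext_delta [simp]: "lin_ext f (delta w) = f w"
  by (subst lin_ext_superset[of "{w}"]) (auto intro: ccontr)

lemma lin_ext_zero_fun [simp]: "lin_ext (\<lambda>w. 0) x = 0"
  by (simp add: lin_ext_def)

lemma lin_ext_add_fun: "lin_ext (\<lambda>w. f w + g w) x = lin_ext f x + lin_ext g x"
  by (simp add: lin_ext_def sum.distrib comb.scale_right_distrib)

lemma lin_ext_diff_fun: "lin_ext (\<lambda>w. f w - g w) x = lin_ext f x - lin_ext g x"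
  by (simp add: lin_ext_def sum_subtractf comb.scale_right_diff_distrib)

lemma
  assumes x: "finite_support x" and y: "finite_support y"
  shows lin_ext_add: "lin_ext f (x + y) = lin_ext f x + lin_ext f y"
    and lin_ext_diff: "lin_ext f (x - y) = lin_ext f x - lin_ext f y"
proof -
  let ?S = "{w. x w \<noteq> 0} \<union> {w. y w \<noteq> 0}"
  have finite_S: "finite ?S" using x y by (simp add: finite_support_def)
  have lin_ext_S: "lin_ext f z = (\<Sum>w\<in>?S. scl (z w) (f w))"
    if "\<And>w. x w = 0 \<Longrightarrow> y w = 0 \<Longrightarrow> z w = 0" for z
    by (rule lin_ext_superset[OF finite_S]) (use that in auto)
  have sums: "lin_ext f x = (\<Sum>w\<in>?S. scl (x w) (f w))" "lin_ext f y = (\<Sum>w\<in>?S. scl (y w) (f w))"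
    "lin_ext f (x + y) = (\<Sum>w\<in>?S. scl (x w + y w) (f w))"
    "lin_ext f (x - y) = (\<Sum>w\<in>?S. scl (x w - y w) (f w))"
    by (subst lin_ext_S; simp)+
  show "lin_ext f (x + y) = lin_ext f x + lin_ext f y"
    by (simp only: sums comb.scale_left_distrib sum.distrib)
  show "lin_ext f (x - y) = lin_ext f x - lin_ext f y"
    by (simp only: sums comb.scale_left_diff_distrib sum_subtractf)
qed

lemma lin_ext_sum_delta:
  "lin_ext f (\<Sum>i\<in>I. scl (c i) (delta (g i))) = (\<Sum>i\<in>I. scl (c i) (f (g i)))"
proof (induction I rule: infinite_finite_induct)
  case (insert i I)
  have "lin_ext f (scl (c i) (delta (g i))) = scl (c i) (f (g i))"
    by (subst lin_ext_superset[of "{g i}"]) (auto intro: ccontr)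
  then show ?case
    by (simp only: sum.insert[OF insert.hyps] lin_ext_add finite_support_sum finite_support_scl
        finite_support_delta insert.IH)
qed (simp_all add: lin_ext_def)

lemma lin_ext_delta_fun: "finite_support x \<Longrightarrow> lin_ext delta x = x"
  unfolding finite_support_def lin_ext_def by (rule comb_eq_sum_delta[symmetric]) auto

lemma comb_linear_lin_ext: "comb_linear L \<Longrightarrow> L (lin_ext f x) = lin_ext (\<lambda>w. L (f w)) x"
  by (simp add: lin_ext_def module_hom.sum module_hom.scale)

lemma lin_ext_swap: "lin_ext (\<lambda>u. lin_ext (f u) y) x = lin_ext (\<lambda>v. lin_ext (\<lambda>u. f u v) x) y"
  unfolding lin_ext_def comb.scale_sum_right
  by (subst sum.swap) (simp add: mult.commute)

lemma lin_ext_in_span: "lin_ext f x \<in> comb.span (f ` {w. x w \<noteq> 0})"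
  unfolding lin_ext_def by (intro comb.span_sum comb.span_scale comb.span_base) blast

subsection \<open>Concatenation\<close>

lemma comb_linear_cat_left: "comb_linear (\<lambda>x. cat x y)"
  by (rule comb_linearI)
    (auto simp: cat_def fun_eq_iff sum.distrib distrib_right sum_distrib_left mult.assoc)

lemma comb_linear_cat_right: "comb_linear (cat x)"
  by (rule comb_linearI)
    (auto simp: cat_def fun_eq_iff sum.distrib distrib_left sum_distrib_left mult.left_commute)

lemmas cat_zero_left [simp] = module_hom.zero[OF comb_linear_cat_left]
  and cat_add_left = module_hom.add[OF comb_linear_cat_left]
  and cat_diff_left = module_hom.diff[OF comb_linear_cat_left]
  and cat_scl_left = module_hom.scale[OF comb_linear_cat_left]
  and cat_sum_left = module_hom.sum[OF comb_linear_cat_left]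
  and cat_lin_ext_left = comb_linear_lin_ext[OF comb_linear_cat_left]

lemmas cat_zero_right [simp] = module_hom.zero[OF comb_linear_cat_right]
  and cat_add_right = module_hom.add[OF comb_linear_cat_right]
  and cat_diff_right = module_hom.diff[OF comb_linear_cat_right]
  and cat_scl_right = module_hom.scale[OF comb_linear_cat_right]
  and cat_sum_right = module_hom.sum[OF comb_linear_cat_right]
  and cat_lin_ext_right = comb_linear_lin_ext[OF comb_linear_cat_right]

lemma cat_Nil_apply [simp]: "cat x y [] = x [] * y []"
  by (simp add: cat_def)

lemma cat_Cons_apply: "cat x y (a # u) = x [] * y (a # u) + cat (\<lambda>w. x (a # w)) y u"
proof -
  have "{..length (a # u)} = insert 0 (Suc ` {..length u})"
    by (simp add: atMost_Suc_eq_insert_0)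
  then show ?thesis
    by (simp add: cat_def sum.reindex)
qed

lemma cat_delta_Nil_left [simp]: "cat (delta []) y = y"
proof
  show "cat (delta []) y u = y u" for u
    by (cases u) (simp_all add: cat_Cons_apply delta_def flip: zero_fun_def)
qed

lemma cat_delta_Nil_right [simp]: "cat x (delta []) = x"
proof
  show "cat x (delta []) u = x u" for u
    by (induction u arbitrary: x) (simp_all add: cat_Cons_apply)
qed

lemma cat_delta_Cons_apply:
  "cat (delta (a # v)) y (b # u) = (if a = b then cat (delta v) y u else 0)"
proof -
  have "(\<lambda>w. delta (a # v) (b # w)) = (if a = b then delta v else 0)"
    by (auto simp: delta_def)
  then have "cat (\<lambda>w. delta (a # v) (b # w)) y u = cat (if a = b then delta v else 0) y u"
    by (rule arg_cong)
  then show ?thesis by (simp add: cat_Cons_apply)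
qed

lemma cat_delta_delta: "cat (delta v) (delta w) = delta (v @ w)"
proof
  show "cat (delta v) (delta w) u = delta (v @ w) u" for u
  proof (induction v arbitrary: u)
    case (Cons a v)
    then show ?case by (cases u) (simp_all add: cat_delta_Cons_apply, simp_all add: delta_def)
  qed simp
qed

lemma cat_assoc: "cat (cat x y) z = cat x (cat y z)"
proof
  show "cat (cat x y) z u = cat x (cat y z) u" for u
  proof (induction u arbitrary: x)
    case (Cons a u)
    have "(\<lambda>w. cat x y (a # w)) = scl (x []) (\<lambda>w. y (a # w)) + cat (\<lambda>v. x (a # v)) y"
      by (simp add: fun_eq_iff cat_Cons_apply)
    then show ?case
      by (simp add: cat_Cons_apply cat_add_left cat_scl_left Cons algebra_simps)
  qed simp
qed

lemma cat_nonzeroE: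
  assumes "cat x y w \<noteq> 0"
  obtains u v where "w = u @ v" "x u \<noteq> 0" "y v \<noteq> 0"
proof -
  obtain i where "x (take i w) * y (drop i w) \<noteq> 0"
    using assms unfolding cat_def by (meson sum.neutral)
  then show ?thesis
    using that[of "take i w" "drop i w"] by simp
qed

lemma finite_support_cat [simp]:
  assumes "finite_support x" "finite_support y"
  shows "finite_support (cat x y)"
proof -
  have "{w. cat x y w \<noteq> 0} \<subseteq> (\<lambda>(u, v). u @ v) ` ({u. x u \<noteq> 0} \<times> {v. y v \<noteq> 0})"
    by (auto elim!: cat_nonzeroE)
  then show ?thesis
    using assms unfolding finite_support_def by (meson finite_SigmaI finite_imageI finite_subset)
qed

lemma cat_append_apply:
  assumes "\<And>w. length w \<noteq> length v \<Longrightarrow> x w = 0"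
  shows "cat x y (v @ u) = x v * y u"
proof -
  have "cat x y (v @ u) = (\<Sum>i\<in>{length v}. x (take i (v @ u)) * y (drop i (v @ u)))"
    unfolding cat_def by (rule sum.mono_neutral_right) (use assms in auto)
  then show ?thesis by simp
qed

lemma lin_ext_cat:
  assumes "finite_support x" "finite_support y"
  shows "lin_ext f (cat x y) = lin_ext (\<lambda>u. lin_ext (\<lambda>v. f (u @ v)) y) x"
proof -
  let ?X = "{u. x u \<noteq> 0}" and ?Y = "{v. y v \<noteq> 0}"
  have "cat x y = cat (lin_ext delta x) (lin_ext delta y)"
    using assms by (simp add: lin_ext_delta_fun)
  also have "\<dots> = (\<Sum>(u, v)\<in>?X \<times> ?Y. scl (x u * y v) (delta (u @ v)))"
    unfolding lin_ext_def cat_sum_left cat_scl_left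
    unfolding cat_sum_right cat_scl_right cat_delta_delta
    by (simp add: comb.scale_sum_right sum.cartesian_product)
  finally have "lin_ext f (cat x y) = (\<Sum>(u, v)\<in>?X \<times> ?Y. scl (x u * y v) (f (u @ v)))"
    using lin_ext_sum_delta[of f "\<lambda>(u, v). x u * y v" "\<lambda>(u, v). u @ v"]
    by (simp add: case_prod_unfold)
  then show ?thesis
    by (simp add: lin_ext_def comb.scale_sum_right sum.cartesian_product)
qed

lemma cat_in_span:
  assumes "x \<in> comb.span X" "y \<in> comb.span Y"
  shows "cat x y \<in> comb.span {cat u v | u v. u \<in> X \<and> v \<in> Y}"
proof -
  let ?C = "{cat u v | u v. u \<in> X \<and> v \<in> Y}"
  have "cat u y \<in> comb.span ?C" if "u \<in> X" for u
  proof -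
    have "cat u y \<in> comb.span (cat u ` Y)"
      using assms(2) by (simp add: module_hom.span_image[OF comb_linear_cat_right])
    also have "\<dots> \<subseteq> comb.span ?C" using that by (intro comb.span_mono) blast
    finally show ?thesis .
  qed
  then have "comb.span ((\<lambda>u. cat u y) ` X) \<subseteq> comb.span ?C"
    by (intro comb.span_minimal) auto
  moreover have "cat x y \<in> comb.span ((\<lambda>u. cat u y) ` X)"
    using assms(1) by (simp add: module_hom.span_image[OF comb_linear_cat_left])
  ultimately show ?thesis by blast
qed

subsection \<open>Homogeneous combinations\<close>

definition homogeneous :: "nat multiset \<Rightarrow> 'a::field comb \<Rightarrow> bool" where
  "homogeneous M x \<longleftrightarrow> (\<forall>w. mset w \<noteq> M \<longrightarrow> x w = 0)"

lemma homogeneousD: "homogeneous M x \<Longrightarrow> x w \<noteq> 0 \<Longrightarrow> mset w = M"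
  by (auto simp: homogeneous_def)

lemma homogeneous_imp_finite_support: "homogeneous M x \<Longrightarrow> finite_support x"
  unfolding finite_support_def homogeneous_def
  by (rule finite_subset[OF _ finite_permutations_of_multiset[of M]])
    (auto simp: permutations_of_multiset_def)

lemma homogeneous_delta: "homogeneous (mset w) (delta w)"
  by (auto simp: homogeneous_def delta_def split: if_splits)

lemma homogeneous_cat:
  assumes "homogeneous M x" "homogeneous N y"
  shows "homogeneous (M + N) (cat x y)"
proof -
  have "mset w = M + N" if "cat x y w \<noteq> 0" for w
    using that assms by (elim cat_nonzeroE) (simp add: homogeneousD)
  then show ?thesis unfolding homogeneous_def by blast
qed

lemma homogeneous_diff: "homogeneous M x \<Longrightarrow> homogeneous M y \<Longrightarrow> homogeneous M (x - y)"
  by (simp add: homogeneous_def)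

section \<open>Left-normed brackets\<close>

definition bracket :: "'a::field comb \<Rightarrow> 'a comb \<Rightarrow> 'a comb" where
  "bracket x y = cat x y - cat y x"

definition ad_word :: "'a::field comb \<Rightarrow> nat list \<Rightarrow> 'a comb" where
  "ad_word = foldl (\<lambda>x a. bracket x (delta [a]))"

fun left_normed :: "nat list \<Rightarrow> 'a::field comb" where
  "left_normed [] = delta []"
| "left_normed (a # w) = ad_word (delta [a]) w"

definition left_normed_prod :: "nat list list \<Rightarrow> 'a::field comb" where
  "left_normed_prod us = foldr (\<lambda>u. cat (left_normed u)) us (delta [])"

lemma comb_linear_bracket_left: "comb_linear (\<lambda>x. bracket x y)"
  by (rule comb_linearI)
    (simp_all only: bracket_def cat_add_left cat_add_right cat_scl_left cat_scl_right
      add_diff_add comb.scale_right_diff_distrib)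

lemmas bracket_lin_ext_left = comb_linear_lin_ext[OF comb_linear_bracket_left]

lemma bracket_jacobi: "bracket (bracket x y) z - bracket (bracket x z) y = bracket x (bracket y z)"
  by (simp add: bracket_def cat_diff_left cat_diff_right cat_assoc)

lemma homogeneous_bracket:
  "homogeneous M x \<Longrightarrow> homogeneous N y \<Longrightarrow> homogeneous (M + N) (bracket x y)"
  using homogeneous_cat[of M x N y] homogeneous_cat[of N y M x]
  by (simp add: bracket_def homogeneous_diff add.commute)

lemma ad_word_Nil [simp]: "ad_word x [] = x"
  and ad_word_Cons: "ad_word x (a # w) = ad_word (bracket x (delta [a])) w"
  and ad_word_snoc: "ad_word x (w @ [a]) = bracket (ad_word x w) (delta [a])"
  and ad_word_append: "ad_word x (u @ v) = ad_word (ad_word x u) v"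
  by (simp_all add: ad_word_def)

lemma comb_linear_ad_word: "comb_linear (\<lambda>x. ad_word x w)"
proof (induction w rule: rev_induct)
  case Nil
  show ?case by (rule comb_linearI) (simp_all only: ad_word_Nil)
next
  case (snoc a w)
  then show ?case
    using module_hom_compose[OF snoc comb_linear_bracket_left[of "delta [a]"]]
    by (simp only: ad_word_snoc o_def)
qed

lemma left_normed_append: "u \<noteq> [] \<Longrightarrow> left_normed (u @ v) = ad_word (left_normed u) v"
  by (cases u) (simp_all add: ad_word_append)

lemma left_normed_snoc: "u \<noteq> [] \<Longrightarrow> left_normed (u @ [a]) = bracket (left_normed u) (delta [a])"
  using ad_word_snoc[of _ "[]"] by (simp add: left_normed_append)

lemma homogeneous_left_normed: "homogeneous (mset w) (left_normed w)"
proof (induction w rule: rev_induct)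
  case (snoc a w)
  then show ?case
    using homogeneous_bracket[OF snoc homogeneous_delta[of "[a]"]] homogeneous_delta[of "[a]"]
    by (cases "w = []") (simp_all add: left_normed_snoc)
qed (use homogeneous_delta[of "[]"] in simp)

lemma finite_support_left_normed [simp]: "finite_support (left_normed w)"
  using homogeneous_left_normed by (rule homogeneous_imp_finite_support)

lemma left_normed_nonzeroD: "left_normed w v \<noteq> 0 \<Longrightarrow> mset v = mset w"
  by (rule homogeneousD[OF homogeneous_left_normed])

lemma left_normed_prod_Nil [simp]: "left_normed_prod [] = delta []"
  and left_normed_prod_Cons [simp]:
    "left_normed_prod (u # us) = cat (left_normed u) (left_normed_prod us)"
  by (simp_all add: left_normed_prod_def)

lemma homogeneous_left_normed_prod: "homogeneous (mset (concat us)) (left_normed_prod us)"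
proof (induction us)
  case (Cons u us)
  then show ?case
    using homogeneous_cat[OF homogeneous_left_normed] by simp
qed (use homogeneous_delta[of "[]"] in simp)

lemma finite_support_left_normed_prod [simp]: "finite_support (left_normed_prod us)"
  using homogeneous_left_normed_prod by (rule homogeneous_imp_finite_support)

lemma left_normed_prod_nonzeroD: "left_normed_prod us v \<noteq> 0 \<Longrightarrow> mset v = mset (concat us)"
  by (rule homogeneousD[OF homogeneous_left_normed_prod])

lemma lin_ext_left_normed_snoc:
  assumes "w \<noteq> []"
  shows "lin_ext f (left_normed (w @ [a])) =
    lin_ext (\<lambda>v. f (v @ [a])) (left_normed w) - lin_ext (\<lambda>v. f (a # v)) (left_normed w)"
  using assms by (simp add: left_normed_snoc bracket_def lin_ext_diff lin_ext_cat)

lemma lin_ext_ad_word_left_normed: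
  assumes "w \<noteq> []"
  shows "lin_ext (ad_word x) (left_normed w) = bracket x (left_normed w)"
  using assms
proof (induction w arbitrary: x rule: rev_nonempty_induct)
  case (single a)
  then show ?case by (simp add: ad_word_def)
next
  case (snoc a w)
  have "lin_ext (ad_word x) (left_normed (w @ [a])) =
    lin_ext (\<lambda>v. bracket (ad_word x v) (delta [a])) (left_normed w)
    - lin_ext (ad_word (bracket x (delta [a]))) (left_normed w)"
    by (simp only: lin_ext_left_normed_snoc[OF snoc.hyps(1)] ad_word_snoc ad_word_Cons)
  also have "\<dots> = bracket (bracket x (left_normed w)) (delta [a]) -
      bracket (bracket x (delta [a])) (left_normed w)"
    by (simp only: snoc.IH flip: bracket_lin_ext_left)
  also have "\<dots> = bracket x (left_normed (w @ [a]))"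
    by (simp only: bracket_jacobi left_normed_snoc[OF snoc.hyps(1)])
  finally show ?case .
qed

theorem dynkin_specht_wever:
  assumes "w \<noteq> []"
  shows "lin_ext left_normed (left_normed w) = scl (of_nat (length w)) (left_normed w)"
  using assms
proof (induction w rule: rev_nonempty_induct)
  case (single a)
  then show ?case by simp
next
  case (snoc a w)
  have "left_normed (v @ [a]) = bracket (left_normed v) (delta [a])"
    if "left_normed w v \<noteq> (0 :: 'a)" for v
    using left_normed_nonzeroD[OF that] snoc.hyps by (intro left_normed_snoc) auto
  then have "lin_ext (\<lambda>v. left_normed (v @ [a])) (left_normed w) =
    lin_ext (\<lambda>v. bracket (left_normed v) (delta [a])) (left_normed w :: 'a comb)"
    by (rule lin_ext_cong)
  then have "lin_ext left_normed (left_normed (w @ [a])) =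
    lin_ext (\<lambda>v. bracket (left_normed v) (delta [a])) (left_normed w)
    - lin_ext (ad_word (delta [a])) (left_normed w :: 'a comb)"
    by (simp only: lin_ext_left_normed_snoc[OF snoc.hyps(1)] left_normed.simps)
  also have "\<dots> = bracket (scl (of_nat (length w)) (left_normed w)) (delta [a]) -
      bracket (delta [a]) (left_normed w)"
    by (simp only: lin_ext_ad_word_left_normed[OF snoc.hyps(1)] snoc.IH flip: bracket_lin_ext_left)
  also have "\<dots> = scl (of_nat (Suc (length w))) (bracket (left_normed w) (delta [a]))"
    by (simp add: bracket_def cat_scl_left cat_scl_right fun_eq_iff algebra_simps)
  also have "\<dots> = scl (of_nat (length (w @ [a]))) (left_normed (w @ [a]))"
    by (simp only: left_normed_snoc[OF snoc.hyps(1)] length_append_singleton)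
  finally show ?case .
qed

section \<open>Primitivity of Lie elements\<close>

fun unshuffle_sum :: "('b list \<Rightarrow> 'b list \<Rightarrow> 'c::comm_monoid_add) \<Rightarrow> 'b list \<Rightarrow> 'c" where
  "unshuffle_sum g [] = g [] []"
| "unshuffle_sum g (a # w) = unshuffle_sum (\<lambda>u v. g (a # u) v) w +
    unshuffle_sum (\<lambda>u v. g u (a # v)) w"

lemma unshuffle_sum_append:
  "unshuffle_sum g (x @ y) = unshuffle_sum (\<lambda>u v. unshuffle_sum (\<lambda>u' v'. g (u @ u') (v @ v')) y) x"
  by (induction x arbitrary: g) simp_all

lemma unshuffle_sum_cong:
  assumes "\<And>u v. w \<in> shuffles u v \<Longrightarrow> g u v = h u v"
  shows "unshuffle_sum g w = unshuffle_sum h w"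
  using assms
proof (induction w arbitrary: g h)
  case (Cons a w)
  have "unshuffle_sum (\<lambda>u v. g (a # u) v) w = unshuffle_sum (\<lambda>u v. h (a # u) v) w"
    "unshuffle_sum (\<lambda>u v. g u (a # v)) w = unshuffle_sum (\<lambda>u v. h u (a # v)) w"
    by (rule Cons.IH; simp add: Cons.prems Cons_in_shuffles_leftI Cons_in_shuffles_rightI)+
  then show ?case by simp
qed simp

lemma unshuffle_sum_zero [simp]: "unshuffle_sum (\<lambda>u v. 0) w = 0"
  by (induction w) simp_all

lemma lin_ext_unshuffle_sum:
  "lin_ext (\<lambda>x. unshuffle_sum (g x) w) y = unshuffle_sum (\<lambda>u v. lin_ext (\<lambda>x. g x u v) y) w"
  by (induction w arbitrary: g) (simp_all only: unshuffle_sum.simps lin_ext_add_fun)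

lemma left_normed_primitive:
  assumes "w \<noteq> []"
  shows "lin_ext (unshuffle_sum g) (left_normed w) =
    lin_ext (\<lambda>v. g v []) (left_normed w) + lin_ext (g []) (left_normed w)"
  using assms
proof (induction w arbitrary: g rule: rev_nonempty_induct)
  case (single a)
  then show ?case by simp
next
  case (snoc a w)
  have "unshuffle_sum g (v @ [a]) =
      unshuffle_sum (\<lambda>x y. g (x @ [a]) y) v + unshuffle_sum (\<lambda>x y. g x (y @ [a])) v" for v
    by (induction v arbitrary: g) (simp_all add: ac_simps)
  then show ?case
    unfolding lin_ext_left_normed_snoc[OF snoc.hyps(1)]
    by (simp add: lin_ext_add_fun snoc.IH del: plus_fun_apply minus_apply)
qed

lemma left_normed_prod_unshuffle:
  assumes "[] \<notin> set Ts"
  shows "lin_ext (unshuffle_sum g) (left_normed_prod Ts) =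
    unshuffle_sum (\<lambda>Us Vs. lin_ext (\<lambda>u. lin_ext (g u) (left_normed_prod Vs))
        (left_normed_prod Us)) Ts"
  using assms
proof (induction Ts arbitrary: g)
  case Nil
  then show ?case by simp
next
  case (Cons t Ts)
  have t_nonempty: "t \<noteq> []" using Cons.prems by auto
  let ?L = "\<lambda>h Us Vs. lin_ext (\<lambda>u. lin_ext (h u) (left_normed_prod Vs)) (left_normed_prod Us)"
  have "lin_ext (unshuffle_sum g) (left_normed_prod (t # Ts)) =
    lin_ext (\<lambda>w. unshuffle_sum (\<lambda>x y.
      lin_ext (unshuffle_sum (\<lambda>u v. g (x @ u) (y @ v))) (left_normed_prod Ts)) w) (left_normed t)"
    by (simp add: lin_ext_cat unshuffle_sum_append lin_ext_unshuffle_sum)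
  also have "\<dots> = lin_ext (\<lambda>w. unshuffle_sum (\<lambda>Us Vs. ?L (\<lambda>u v. g (w @ u) v) Us Vs) Ts) (left_normed t)
    + lin_ext (\<lambda>w. unshuffle_sum (\<lambda>Us Vs. ?L (\<lambda>u v. g u (w @ v)) Us Vs) Ts) (left_normed t)"
    unfolding left_normed_primitive[OF t_nonempty] using Cons by simp
  also have "\<dots> = unshuffle_sum (\<lambda>Us Vs. ?L g (t # Us) Vs) Ts +
      unshuffle_sum (\<lambda>Us Vs. ?L g Us (t # Vs)) Ts"
    by (simp add: lin_ext_unshuffle_sum lin_ext_cat lin_ext_swap[of _ _ "left_normed t"])
  finally show ?case by simp
qed

section \<open>Convolution of Dynkin operators\<close>

lemma shuffles_distinctD:
  assumes "w \<in> shuffles u v" "distinct w"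
  shows "distinct u" "distinct v" "set u \<inter> set v = {}"
proof -
  have "distinct (u @ v)"
    using assms mset_shuffles[OF assms(1)] by (metis mset_append mset_eq_imp_distinct_iff)
  then show "distinct u" "distinct v" "set u \<inter> set v = {}" by auto
qed

lemma shuffles_imp_subseq:
  assumes "w \<in> shuffles u v"
  shows "subseq u w" "subseq v w"
  using assms by (induction u v arbitrary: w rule: shuffles.induct) auto

lemma finite_splits: "finite {(u, v). w \<in> shuffles u v}"
  by (rule finite_subset[of _ "set (subseqs w) \<times> set (subseqs w)"])
    (auto intro: shuffles_imp_subseq)

lemma unshuffle_sum_distinct:
  assumes "distinct w"
  shows "unshuffle_sum g w = (\<Sum>(u, v) | w \<in> shuffles u v. g u v)"
  using assms
proof (induction w arbitrary: g)
  case Nil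
  have "{(u, v). [] \<in> shuffles u v} = {([] :: 'a list, [] :: 'a list)}" by auto
  then show ?case by simp
next
  case (Cons a w)
  let ?S = "{(u, v). w \<in> shuffles u v}"
  let ?L = "(\<lambda>(u, v). (a # u, v)) ` ?S" and ?R = "(\<lambda>(u, v). (u, a # v)) ` ?S"
  have splits: "{(u, v). a # w \<in> shuffles u v} = ?L \<union> ?R"
    by (force simp: Cons_in_shuffles_iff neq_Nil_conv)
  have disj: "?L \<inter> ?R = {}"
    using Cons.prems by (auto dest: set_shuffles)
  have "(\<Sum>(u, v)\<in>?L. g u v) = unshuffle_sum (\<lambda>u v. g (a # u) v) w"
    "(\<Sum>(u, v)\<in>?R. g u v) = unshuffle_sum (\<lambda>u v. g u (a # v)) w"
    using Cons by (subst sum.reindex; auto simp: inj_on_def case_prod_unfold)+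
  then show ?case
    unfolding splits by (subst sum.union_disjoint) (use disj finite_splits[of w] in auto)
qed

lemma in_shuffles_singleton_iff:
  assumes "distinct w"
  shows "w \<in> shuffles [a] v \<longleftrightarrow> a \<in> set w \<and> v = remove1 a w"
proof
  assume w: "w \<in> shuffles [a] v"
  then have "set [a] \<inter> set v = {}" by (intro shuffles_distinctD[OF _ assms])
  then have "filter (\<lambda>x. x \<notin> set [a]) w = v" using w by (rule filter_shuffles_disjoint1)
  then have "v = remove1 a w"
    using assms by (simp add: distinct_remove1_removeAll removeAll_filter_not_eq eq_commute[of a])
  then show "a \<in> set w \<and> v = remove1 a w" using set_shuffles[OF w] by simp
next
  assume a: "a \<in> set w \<and> v = remove1 a w"
  have "filter (\<lambda>x. a = x) w = [a]"
    using conjunct1[OF a] assms by (induction w) (auto simp: filter_empty_conv)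
  moreover have "filter (\<lambda>x. a \<noteq> x) w = v"
    using a assms by (simp add: distinct_remove1_removeAll removeAll_filter_not_eq)
  ultimately show "w \<in> shuffles [a] v" using partition_in_shuffles[of w "\<lambda>x. a = x"] by simp
qed

lemma unshuffle_sum_singletons:
  assumes "distinct w" "\<And>u v. w \<in> shuffles u v \<Longrightarrow> length u \<noteq> 1 \<Longrightarrow> g u v = 0"
  shows "unshuffle_sum g w = (\<Sum>a\<in>set w. g [a] (remove1 a w))"
proof -
  let ?P = "(\<lambda>a. ([a], remove1 a w)) ` set w"
  have "unshuffle_sum g w = (\<Sum>(u, v) | w \<in> shuffles u v. g u v)"
    by (rule unshuffle_sum_distinct[OF assms(1)])
  also have "\<dots> = (\<Sum>(u, v)\<in>?P. g u v)"
  proof (rule sum.mono_neutral_right[OF finite_splits])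
    show "?P \<subseteq> {(u, v). w \<in> shuffles u v}"
      by (auto simp: in_shuffles_singleton_iff[OF assms(1)])
    show "\<forall>p\<in>{(u, v). w \<in> shuffles u v} - ?P. (case p of (u, v) \<Rightarrow> g u v) = 0"
    proof clarify
      fix u v assume uv: "w \<in> shuffles u v" "(u, v) \<notin> ?P"
      have "length u \<noteq> 1"
        using uv in_shuffles_singleton_iff[OF assms(1)] by (auto simp: length_Suc_conv)
      then show "g u v = 0" by (rule assms(2)[OF uv(1)])
    qed
  qed
  also have "\<dots> = (\<Sum>a\<in>set w. g [a] (remove1 a w))"
    by (subst sum.reindex) (auto simp: inj_on_def)
  finally show ?thesis .
qed

text \<open>The action of \<open>\<omega>\<^sub>q\<close> on words without repetitions, as shown in \<open>act_omega_q\<close>.\<close>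

fun dynkin_conv :: "nat list \<Rightarrow> nat list \<Rightarrow> 'a::field comb" where
  "dynkin_conv [] w = (if w = [] then delta [] else 0)"
| "dynkin_conv (m # q) w =
    unshuffle_sum (\<lambda>u v. if length u = m then cat (left_normed u) (dynkin_conv q v) else 0) w"

lemma lin_ext_dynkin_conv_Cons:
  assumes "[] \<notin> set Ts"
  shows "lin_ext (dynkin_conv (m # q)) (left_normed_prod Ts) =
    unshuffle_sum (\<lambda>Us Vs. if length (concat Us) = m
      then cat (lin_ext left_normed (left_normed_prod Us))
        (lin_ext (dynkin_conv q) (left_normed_prod Vs))
      else 0 :: 'a::field comb) Ts"
proof -
  let ?g = "\<lambda>u v. if length u = m then cat (left_normed u) (dynkin_conv q v) else 0 :: 'a comb"
  let ?D = "\<lambda>Vs. lin_ext (dynkin_conv q) (left_normed_prod Vs)"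
  have "lin_ext (\<lambda>u. lin_ext (?g u) (left_normed_prod Vs)) (left_normed_prod Us) =
    (if length (concat Us) = m then cat (lin_ext left_normed (left_normed_prod Us)) (?D Vs) else 0)"
    for Us Vs
  proof -
    have "lin_ext (?g u) (left_normed_prod Vs) =
      (if length (concat Us) = m then cat (left_normed u) (?D Vs) else 0)"
      if "left_normed_prod Us u \<noteq> (0 :: 'a)" for u
      using left_normed_prod_nonzeroD[OF that, THEN mset_eq_length] by (simp add: cat_lin_ext_right)
    then have "lin_ext (\<lambda>u. lin_ext (?g u) (left_normed_prod Vs)) (left_normed_prod Us) =
      lin_ext (\<lambda>u. if length (concat Us) = m then cat (left_normed u) (?D Vs) else 0)
        (left_normed_prod Us)"
      by (rule lin_ext_cong)
    then show ?thesis by (simp add: cat_lin_ext_left)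
  qed
  moreover have "dynkin_conv (m # q) = unshuffle_sum ?g" by (rule ext) simp
  ultimately show ?thesis
    by (simp only: left_normed_prod_unshuffle[OF assms])
qed

lemma lin_ext_dynkin_conv_short:
  assumes "[] \<notin> set Ts" "0 \<notin> set q" "length Ts < length q"
  shows "lin_ext (dynkin_conv q) (left_normed_prod Ts) = (0 :: 'a::field comb)"
  using assms
proof (induction q arbitrary: Ts)
  case (Cons m q)
  have "lin_ext (dynkin_conv q) (left_normed_prod Vs) = (0 :: 'a comb)"
    if "Ts \<in> shuffles Us Vs" "length (concat Us) = m" for Us Vs
  proof (rule Cons.IH)
    have "Us \<noteq> []" using that(2) Cons.prems(2) by auto
    then show "length Vs < length q"
      using length_shuffles[OF that(1)] Cons.prems(3) by (cases Us) auto
  qed (use Cons.prems set_shuffles[OF that(1)] in auto)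
  then show ?case
    unfolding lin_ext_dynkin_conv_Cons[OF Cons.prems(1)]
    by (subst unshuffle_sum_cong[where h = "\<lambda>_ _. 0"]) auto
qed simp

definition sym_prod :: "nat list \<Rightarrow> nat list set \<Rightarrow> 'a::field comb" where
  "sym_prod q S = (\<Sum>us | us \<in> permutations_of_set S \<and> map length us = q. left_normed_prod us)"

lemma sym_prod_Nil [simp]: "sym_prod [] {} = delta []"
  by (simp add: sym_prod_def)

lemma sym_prod_Cons:
  assumes "finite S"
  shows "sym_prod (m # q) S =
    (\<Sum>t | t \<in> S \<and> length t = m. cat (left_normed t) (sym_prod q (S - {t})))"
proof -
  let ?R = "\<lambda>q S. {us. us \<in> permutations_of_set S \<and> map length us = q}"
  have "(\<Sum>t | t \<in> S \<and> length t = m. cat (left_normed t) (sym_prod q (S - {t}))) =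
    (\<Sum>(t, us)\<in>(SIGMA t:{t. t \<in> S \<and> length t = m}. ?R q (S - {t})). left_normed_prod (t # us))"
    using assms by (simp add: sym_prod_def cat_sum_right sum.Sigma)
  also have "\<dots> = sym_prod (m # q) S"
    unfolding sym_prod_def
  proof (rule sum.reindex_bij_witness[where i = "\<lambda>us. (hd us, tl us)" and j = "\<lambda>(t, us). t # us"])
    fix us assume us: "us \<in> ?R (m # q) S"
    then obtain t vs where "us = t # vs" by (cases us) auto
    then show "(hd us, tl us) \<in> (SIGMA t:{t. t \<in> S \<and> length t = m}. ?R q (S - {t}))"
      "(case (hd us, tl us) of (t, us) \<Rightarrow> t # us) = us"
      using us by (auto simp: permutations_of_set_def)
  next
    fix p assume "p \<in> (SIGMA t:{t. t \<in> S \<and> length t = m}. ?R q (S - {t}))"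
    then obtain t us where p: "p = (t, us)" "t \<in> S" "length t = m" "us \<in> ?R q (S - {t})" by auto
    then show "(case p of (t, us) \<Rightarrow> t # us) \<in> ?R (m # q) S"
      by (simp add: permutations_of_set_def insert_absorb)
  qed auto
  finally show ?thesis ..
qed

lemma lin_ext_dynkin_conv_Cons_eq_length:
  assumes "distinct Ts" "[] \<notin> set Ts" "0 \<notin> set (m # q)" "length Ts = length (m # q)"
  shows "lin_ext (dynkin_conv (m # q)) (left_normed_prod Ts) =
    (\<Sum>t | t \<in> set Ts \<and> length t = m. scl (of_nat m) (cat (left_normed t)
      (lin_ext (dynkin_conv q) (left_normed_prod (remove1 t Ts)))) :: 'a::field comb)"
proof -
  let ?D = "\<lambda>Vs. lin_ext (dynkin_conv q) (left_normed_prod Vs) :: 'a comb"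
  let ?g = "\<lambda>Us Vs. if length (concat Us) = m
    then cat (lin_ext left_normed (left_normed_prod Us)) (?D Vs) else 0"
  have zero: "?g Us Vs = 0" if "Ts \<in> shuffles Us Vs" "length Us \<noteq> 1" for Us Vs
  proof (cases "Us = []")
    case False
    then have "length Us \<ge> 2" using that(2) by (cases Us) (auto simp: Suc_le_eq)
    then have "length Vs < length q" using length_shuffles[OF that(1)] assms(4) by simp
    moreover have "[] \<notin> set Vs" using set_shuffles[OF that(1)] assms(2) by simp
    ultimately have "?D Vs = 0" using assms(3) by (intro lin_ext_dynkin_conv_short) simp_all
    then show ?thesis by simp
  qed (use assms(3) in auto)
  have "lin_ext (dynkin_conv (m # q)) (left_normed_prod Ts) = (\<Sum>t\<in>set Ts. ?g [t] (remove1 t Ts))"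
    unfolding lin_ext_dynkin_conv_Cons[OF assms(2)] using assms(1) zero
    by (rule unshuffle_sum_singletons)
  also have "\<dots> = (\<Sum>t\<in>set Ts.
      if length t = m then scl (of_nat m) (cat (left_normed t) (?D (remove1 t Ts))) else 0)"
  proof (rule sum.cong[OF refl])
    fix t assume "t \<in> set Ts"
    then have "t \<noteq> []" using assms(2) by blast
    then show "?g [t] (remove1 t Ts) =
        (if length t = m then scl (of_nat m) (cat (left_normed t) (?D (remove1 t Ts))) else 0)"
      by (simp add: dynkin_specht_wever cat_scl_left)
  qed
  finally show ?thesis by (simp only: sum.inter_filter[OF finite_set])
qed

theorem lin_ext_dynkin_conv:
  assumes "distinct Ts" "[] \<notin> set Ts" "0 \<notin> set q" "length Ts = length q"
  shows "lin_ext (dynkin_conv q) (left_normed_prod Ts) =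
    (scl (of_nat (prod_list q)) (sym_prod q (set Ts)) :: 'a::field comb)"
  using assms
proof (induction q arbitrary: Ts)
  case Nil
  then show ?case by simp
next
  case (Cons m q)
  have IH: "lin_ext (dynkin_conv q) (left_normed_prod (remove1 t Ts)) =
      (scl (of_nat (prod_list q)) (sym_prod q (set Ts - {t})) :: 'a comb)" if "t \<in> set Ts" for t
    unfolding set_remove1_eq[OF Cons.prems(1), symmetric]
    by (rule Cons.IH) (use Cons.prems that in \<open>auto simp: length_remove1\<close>)
  have "lin_ext (dynkin_conv (m # q)) (left_normed_prod Ts) =
    (\<Sum>t | t \<in> set Ts \<and> length t = m. scl (of_nat (prod_list (m # q)))
      (cat (left_normed t) (sym_prod q (set Ts - {t}))) :: 'a comb)"
    unfolding lin_ext_dynkin_conv_Cons_eq_length[OF Cons.prems]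
    by (rule sum.cong) (simp_all add: IH cat_scl_right)
  then show ?case by (simp only: sym_prod_Cons[OF finite_set] comb.scale_sum_right)
qed

subsection \<open>Unshuffles of a word without repetitions\<close>

definition unshuffles :: "nat list \<Rightarrow> nat list \<Rightarrow> nat list list set" where
  "unshuffles q w = {us. map length us = q \<and> mset (concat us) = mset w \<and> (\<forall>u\<in>set us. subseq u w)}"

lemma finite_unshuffles: "finite (unshuffles q w)"
proof (rule finite_subset)
  show "unshuffles q w \<subseteq> {us. set us \<subseteq> set (subseqs w) \<and> length us = length q}"
    unfolding unshuffles_def set_subseqs_eq by (auto simp only: length_map mem_Collect_eq)
qed (simp add: finite_lists_length_eq)

lemma subseq_distinct_filter:
  assumes "subseq u w" "distinct w"
  shows "filter (\<lambda>x. x \<in> set u) w = u"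
  using assms
proof (induction rule: list_emb.induct)
  case (list_emb_Cons u w y)
  then have "y \<notin> set u"
    using list_emb_Cons.prems by (auto elim: list_emb_set[OF list_emb_Cons.hyps])
  then show ?case using list_emb_Cons by simp
next
  case (list_emb_Cons2 x y u w)
  have "filter (\<lambda>z. z \<in> set (x # u)) w = filter (\<lambda>z. z \<in> set u) w"
    using list_emb_Cons2 by (intro filter_cong) auto
  then show ?case using list_emb_Cons2 by simp
qed simp

lemma unshuffles_Nil: "unshuffles [] w = (if w = [] then {[]} else {})"
  by (auto simp: unshuffles_def)

lemma Cons_in_unshuffles_iff:
  assumes "distinct w"
  shows "u # us \<in> unshuffles (m # q) w \<longleftrightarrow>
    length u = m \<and> (\<exists>v. w \<in> shuffles u v \<and> us \<in> unshuffles q v)"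
proof
  assume unshuffle: "u # us \<in> unshuffles (m # q) w"
  let ?v = "filter (\<lambda>x. x \<notin> set u) w"
  have filter_in: "filter (\<lambda>x. x \<in> set u) w = u"
    using unshuffle assms by (intro subseq_distinct_filter) (auto simp: unshuffles_def)
  have shuffle: "w \<in> shuffles u ?v"
    using partition_in_shuffles[of w "\<lambda>x. x \<in> set u"] unfolding filter_in .
  have "mset u + mset (concat us) = mset w" using unshuffle by (simp add: unshuffles_def)
  also have "\<dots> = mset u + mset ?v" by (rule mset_shuffles[OF shuffle])
  finally have content: "mset (concat us) = mset ?v" by simp
  have "subseq x ?v" if x_in: "x \<in> set us" for x
  proof -
    have "set x \<subseteq> set (concat us)" using x_in by auto
    also have "set (concat us) = set ?v" by (rule mset_eq_setD[OF content])
    finally have "filter (\<lambda>y. y \<notin> set u) x = x" by (auto intro!: filter_True)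
    moreover have "subseq x w" using unshuffle x_in by (simp add: unshuffles_def)
    ultimately show ?thesis by (metis subseq_filter)
  qed
  then have "us \<in> unshuffles q ?v" using unshuffle content by (simp add: unshuffles_def)
  then show "length u = m \<and> (\<exists>v. w \<in> shuffles u v \<and> us \<in> unshuffles q v)"
    using unshuffle shuffle by (auto simp: unshuffles_def)
next
  assume "length u = m \<and> (\<exists>v. w \<in> shuffles u v \<and> us \<in> unshuffles q v)"
  then obtain v where v: "length u = m" "w \<in> shuffles u v" "us \<in> unshuffles q v" by blast
  have "subseq x w" if "x \<in> set us" for x
    using that v(3) shuffles_imp_subseq(2)[OF v(2)] subseq_order.order_trans
    unfolding unshuffles_def by blast
  then show "u # us \<in> unshuffles (m # q) w"
    using v shuffles_imp_subseq(1)[OF v(2)] mset_shuffles[OF v(2)] by (simp add: unshuffles_def)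
qed

lemma sum_unshuffles_Cons:
  assumes "distinct w"
  shows "(\<Sum>us\<in>unshuffles (m # q) w. f us) =
    (\<Sum>(u, v) | w \<in> shuffles u v \<and> length u = m. \<Sum>us\<in>unshuffles q v. f (u # us))"
proof -
  let ?T = "{(u, v). w \<in> shuffles u v \<and> length u = m}"
  let ?i = "\<lambda>us. ((hd us, filter (\<lambda>x. x \<notin> set (hd us)) w), tl us)"
  have rest: "filter (\<lambda>x. x \<notin> set u) w = v" if "w \<in> shuffles u v" for u v
    by (rule filter_shuffles_disjoint1(2)[OF shuffles_distinctD(3)[OF that assms] that])
  have "(\<Sum>p\<in>?T. \<Sum>us\<in>unshuffles q (snd p). f (fst p # us)) =
    (\<Sum>(p, us)\<in>(SIGMA p:?T. unshuffles q (snd p)). f (fst p # us))"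
    by (intro sum.Sigma finite_subset[OF _ finite_splits[of w]]) (auto simp: finite_unshuffles)
  also have "\<dots> = (\<Sum>us\<in>unshuffles (m # q) w. f us)"
  proof (rule sum.reindex_bij_witness[where j = "\<lambda>(p, us). fst p # us" and i = ?i])
    fix a assume "a \<in> (SIGMA p:?T. unshuffles q (snd p))"
    then obtain u v us where a: "a = ((u, v), us)" "w \<in> shuffles u v" "length u = m"
      "us \<in> unshuffles q v" by auto
    show "?i (case a of (p, us) \<Rightarrow> fst p # us) = a"
      by (simp add: a(1) rest[OF a(2)])
    have "u # us \<in> unshuffles (m # q) w"
      using a(2-4) Cons_in_unshuffles_iff[OF assms] by blast
    then show "(case a of (p, us) \<Rightarrow> fst p # us) \<in> unshuffles (m # q) w"
      by (simp add: a(1))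
  next
    fix b assume b: "b \<in> unshuffles (m # q) w"
    then obtain u us where us: "b = u # us" by (auto simp: unshuffles_def)
    then obtain v where v: "w \<in> shuffles u v" "length u = m" "us \<in> unshuffles q v"
      using b Cons_in_unshuffles_iff[OF assms] by blast
    then show "?i b \<in> (SIGMA p:?T. unshuffles q (snd p))" "(case ?i b of (p, us) \<Rightarrow> fst p # us) = b"
      by (simp_all add: us rest[OF v(1)])
  qed auto
  finally show ?thesis by (simp add: case_prod_unfold)
qed

lemma dynkin_conv_eq_sum_unshuffles:
  assumes "distinct w"
  shows "dynkin_conv q w = (\<Sum>us\<in>unshuffles q w. left_normed_prod us :: 'a::field comb)"
  using assms
proof (induction q arbitrary: w)
  case Nil
  then show ?case by (simp add: unshuffles_Nil flip: zero_fun_def)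
next
  case (Cons m q)
  let ?T = "{(u, v). w \<in> shuffles u v \<and> length u = m}"
  have "dynkin_conv (m # q) w = (\<Sum>(u, v) | w \<in> shuffles u v.
      if length u = m then cat (left_normed u) (dynkin_conv q v) else 0 :: 'a comb)"
    unfolding dynkin_conv.simps by (rule unshuffle_sum_distinct[OF Cons.prems])
  also have "\<dots> = (\<Sum>(u, v)\<in>?T. cat (left_normed u) (dynkin_conv q v))"
    by (rule sum.mono_neutral_cong_right[OF finite_splits]) auto
  also have "\<dots> = (\<Sum>(u, v)\<in>?T. \<Sum>us\<in>unshuffles q v. left_normed_prod (u # us))"
    using Cons.prems
    by (intro sum.cong refl) (auto simp: Cons.IH[OF shuffles_distinctD(2)] cat_sum_right)
  also have "\<dots> = (\<Sum>us\<in>unshuffles (m # q) w. left_normed_prod us)"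
    by (rule sum_unshuffles_Cons[OF Cons.prems, symmetric])
  finally show ?case .
qed

lemma unshuffles_distinct:
  assumes "us \<in> unshuffles q w" "distinct w" "0 \<notin> set q"
  shows "distinct us" "[] \<notin> set us" "distinct (concat us)"
proof -
  show d: "distinct (concat us)"
    using assms mset_eq_imp_distinct_iff unfolding unshuffles_def by blast
  show ne: "[] \<notin> set us" using assms by (force simp: unshuffles_def)
  then show "distinct us" using d by (simp add: distinct_concat_iff removeAll_id)
qed

lemma dynkin_conv_eq_sum_sym_prod:
  assumes "distinct w" "0 \<notin> set q"
  shows "dynkin_conv q w = (\<Sum>S\<in>set ` unshuffles q w. sym_prod q S :: 'a::field comb)"
proof -
  have fibre: "{us \<in> unshuffles q w. set us = set ts} =
    {us. us \<in> permutations_of_set (set ts) \<and> map length us = q}" if ts: "ts \<in> unshuffles q w" for ts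
  proof (intro set_eqI iffI)
    fix us assume "us \<in> {us \<in> unshuffles q w. set us = set ts}"
    then show "us \<in> {us. us \<in> permutations_of_set (set ts) \<and> map length us = q}"
      using unshuffles_distinct(1)[OF _ assms] by (auto simp: unshuffles_def)
  next
    fix us assume us: "us \<in> {us. us \<in> permutations_of_set (set ts) \<and> map length us = q}"
    then have "mset us = mset ts"
      using unshuffles_distinct(1)[OF ts assms] set_eq_iff_mset_eq_distinct
      by (auto simp: permutations_of_set_def)
    moreover have "mset (concat vs) = \<Sum>\<^sub># (image_mset mset (mset vs))" for vs :: "nat list list"
      by (simp add: mset_concat flip: sum_mset_sum_list)
    ultimately have "mset (concat us) = mset (concat ts)" by simp
    then show "us \<in> {us \<in> unshuffles q w. set us = set ts}"
      using us ts by (auto simp: unshuffles_def permutations_of_set_def)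
  qed
  have "dynkin_conv q w = (\<Sum>S\<in>set ` unshuffles q w.
      \<Sum>us | us \<in> unshuffles q w \<and> set us = S. left_normed_prod us :: 'a comb)"
    unfolding dynkin_conv_eq_sum_unshuffles[OF assms(1)]
    by (rule sum.image_gen[OF finite_unshuffles])
  also have "\<dots> = (\<Sum>S\<in>set ` unshuffles q w. sym_prod q S)"
    unfolding sym_prod_def by (rule sum.cong) (auto simp: fibre)
  finally show ?thesis .
qed

section \<open>Words starting with their smallest letter\<close>

definition min_first :: "nat list \<Rightarrow> bool" where
  "min_first w \<longleftrightarrow> w \<noteq> [] \<and> distinct w \<and> hd w = Min (set w)"

lemma min_firstD:
  assumes "min_first w"
  shows "w \<noteq> []" "distinct w"
  using assms by (simp_all add: min_first_def)

lemma left_normed_in_span_hd: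
  assumes "a \<in> set w"
  shows "(left_normed w :: 'a::field comb) \<in>
      comb.span {left_normed (a # v) | v. mset (a # v) = mset w}"
proof -
  obtain x y where w: "w = x @ a # y" using assms by (meson split_list)
  show ?thesis
  proof (cases "x = []")
    case True
    then show ?thesis using w by (intro comb.span_base) auto
  next
    case False
    let ?f = "\<lambda>v. left_normed (a # v @ y) :: 'a comb"
    have "left_normed w = (ad_word (bracket (left_normed x) (delta [a])) y :: 'a comb)"
      using False left_normed_append[of "x @ [a]" y] by (simp add: w left_normed_snoc)
    also have "bracket (left_normed x) (delta [a]) =
        - lin_ext (ad_word (delta [a])) (left_normed x)"
      using False by (simp add: lin_ext_ad_word_left_normed) (simp add: bracket_def)
    also have "ad_word (- lin_ext (ad_word (delta [a])) (left_normed x)) y =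
        - lin_ext ?f (left_normed x)"
      by (simp add: module_hom.neg[OF comb_linear_ad_word]
        comb_linear_lin_ext[OF comb_linear_ad_word] ad_word_append)
    finally have "left_normed w \<in> comb.span (?f ` {v. left_normed x v \<noteq> (0 :: 'a)})"
      by (simp only:) (intro comb.span_neg lin_ext_in_span)
    moreover have "?f ` {v. left_normed x v \<noteq> (0 :: 'a)} \<subseteq>
        {left_normed (a # v) | v. mset (a # v) = mset w}"
      using w by (auto dest!: left_normed_nonzeroD)
    ultimately show ?thesis using comb.span_mono by blast
  qed
qed

lemma left_normed_in_span_min_first:
  assumes "distinct w" "w \<noteq> []"
  shows "(left_normed w :: 'a::field comb) \<in>
      comb.span {left_normed v | v. min_first v \<and> mset v = mset w}"
proof -
  have "min_first (Min (set w) # v)" if "mset (Min (set w) # v) = mset w" for v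
    using that mset_eq_setD[OF that] mset_eq_imp_distinct_iff[OF that] assms
    by (simp add: min_first_def)
  then have "{left_normed (Min (set w) # v) | v. mset (Min (set w) # v) = mset w} \<subseteq>
      {left_normed v :: 'a comb | v. min_first v \<and> mset v = mset w}" by blast
  moreover have "Min (set w) \<in> set w" using assms by simp
  ultimately show ?thesis
    by (rule subsetD[OF comb.span_mono left_normed_in_span_hd])
qed

lemma left_normed_prod_in_span_min_first:
  assumes "\<And>u. u \<in> set us \<Longrightarrow> distinct u \<and> u \<noteq> []"
  shows "(left_normed_prod us :: 'a::field comb) \<in> comb.span
    {left_normed_prod vs | vs. (\<forall>v\<in>set vs. min_first v) \<and> map mset vs = map mset us}"
  using assms
proof (induction us)
  case Nil
  then show ?case by (intro comb.span_base) simp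
next
  case (Cons u us)
  let ?X = "{left_normed v :: 'a comb | v. min_first v \<and> mset v = mset u}"
  let ?Y = "\<lambda>us. {left_normed_prod vs :: 'a comb | vs.
    (\<forall>v\<in>set vs. min_first v) \<and> map mset vs = map mset us}"
  have "left_normed_prod (u # us) \<in> comb.span {cat x y | x y. x \<in> ?X \<and> y \<in> ?Y us}"
    unfolding left_normed_prod_Cons
    by (intro cat_in_span left_normed_in_span_min_first Cons.IH) (use Cons.prems in auto)
  also have "\<dots> \<subseteq> comb.span (?Y (u # us))"
  proof (rule comb.span_mono, clarify)
    fix v vs assume "min_first v" "mset v = mset u"
      and "\<forall>v\<in>set vs. min_first v" "map mset vs = map mset us"
    then show "\<exists>ws. cat (left_normed v) (left_normed_prod vs) = left_normed_prod ws \<and>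
        (\<forall>w\<in>set ws. min_first w) \<and> map mset ws = map mset (u # us)"
      by (intro exI[of _ "v # vs"]) simp
  qed
  finally show ?case .
qed

lemma cat_delta_single_right_apply:
  "cat x (delta [b]) w = (if w \<noteq> [] \<and> last w = b then x (butlast w) else 0)"
  by (induction w arbitrary: x) (simp_all add: cat_Cons_apply delta_def)

lemma left_normed_Cons_apply_Cons:
  assumes "a \<notin> set v"
  shows "left_normed (a # v) (a # u) = (if u = v then 1 else 0 :: 'a::field)"
  using assms
proof (induction v arbitrary: u rule: rev_induct)
  case Nil
  then show ?case by (simp add: delta_def)
next
  case (snoc b v)
  have "left_normed (a # v @ [b]) = (bracket (left_normed (a # v)) (delta [b]) :: 'a comb)"
    using left_normed_snoc[of "a # v" b] by simp
  then have "left_normed (a # v @ [b]) (a # u) =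
      (cat (left_normed (a # v)) (delta [b]) (a # u) :: 'a)"
    using snoc.prems by (simp add: bracket_def cat_delta_Cons_apply)
  then show ?case
    using snoc by (cases u rule: rev_cases)
      (auto simp: cat_delta_single_right_apply butlast_append simp del: left_normed.simps)
qed

lemma left_normed_min_first_apply:
  assumes "min_first s" "min_first t"
  shows "left_normed s t = (if s = t then 1 else 0 :: 'a::field)"
proof (cases "set s = set t")
  case True
  then obtain a u v where "s = a # u" "t = a # v"
    using assms by (cases s; cases t) (auto simp: min_first_def)
  then show ?thesis
    using left_normed_Cons_apply_Cons[of a u v] assms by (auto simp: min_first_def)
next
  case False
  then show ?thesis
    using left_normed_nonzeroD[of s t, where ?'a = 'a, THEN mset_eq_setD] by auto
qed

lemma left_normed_prod_min_first_apply:
  assumes "map length us = map length ts" "\<forall>u\<in>set us. min_first u" "\<forall>t\<in>set ts. min_first t"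
  shows "left_normed_prod us (concat ts) = (if us = ts then 1 else 0 :: 'a::field)"
  using assms
proof (induction us arbitrary: ts)
  case (Cons u us)
  then obtain t ts' where ts: "ts = t # ts'" "length u = length t" by (cases ts) auto
  have "left_normed u w = (0 :: 'a)" if "length w \<noteq> length t" for w
    using that left_normed_nonzeroD[of u w, THEN mset_eq_length] ts(2) by auto
  then have "left_normed_prod (u # us) (concat ts) =
      left_normed u t * (left_normed_prod us (concat ts') :: 'a)"
    by (simp add: ts(1) cat_append_apply)
  then show ?case
    using Cons ts(1) by (simp add: left_normed_min_first_apply)
qed simp

lemma sym_prod_min_first_apply:
  assumes "finite S" "\<forall>s\<in>S. min_first s" "map length ts = q" "\<forall>t\<in>set ts. min_first t"
  shows "sym_prod q S (concat ts) = (if ts \<in> permutations_of_set S then 1 else 0 :: 'a::field)"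
proof -
  let ?P = "{us. us \<in> permutations_of_set S \<and> map length us = q}"
  have "finite ?P" by (rule finite_subset[OF _ finite_permutations_of_set[of S]]) auto
  moreover have "sym_prod q S (concat ts) = (\<Sum>us\<in>?P. if us = ts then 1 else 0 :: 'a)"
    unfolding sym_prod_def sum_comb_apply using assms
    by (intro sum.cong refl left_normed_prod_min_first_apply) (auto simp: permutations_of_set_def)
  ultimately show ?thesis using assms(3) by simp
qed

section \<open>The group algebra acting on words\<close>

lemma perms_eq: "perms n = permutations_of_set {1..n}"
  by (auto simp: perms_def permutations_of_set_def)

lemma finite_perms [simp]: "finite (perms n)"
  by (simp add: perms_eq)

lemma length_perms: "w \<in> perms n \<Longrightarrow> length w = n"
  unfolding perms_eq using length_finite_permutations_of_set by fastforce

lemma perms_cong_mset: "mset v = mset w \<Longrightarrow> v \<in> perms n \<longleftrightarrow> w \<in> perms n"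
  using mset_eq_setD mset_eq_imp_distinct_iff unfolding perms_def by blast

lemma map_nth_upt:
  assumes "b \<le> length w"
  shows "map (\<lambda>j. w ! (j - 1)) [a + 1..<b + 1] = take (b - a) (drop a w)"
  by (rule nth_equalityI) (use assms in \<open>auto simp del: upt_Suc\<close>)

lemma bij_betw_nth_pred:
  assumes "distinct w" "length w = n"
  shows "bij_betw (\<lambda>j. w ! (j - 1)) {1..n} (set w)"
proof (rule bij_betw_imageI)
  show "inj_on (\<lambda>j. w ! (j - 1)) {1..n}"
    using assms by (auto simp: inj_on_def nth_eq_iff_index_eq)
  have "map (\<lambda>j. w ! (j - 1)) [0 + 1..<n + 1] = w"
    using assms by (subst map_nth_upt) auto
  then show "(\<lambda>j. w ! (j - 1)) ` {1..n} = set w"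
    using list.set_map[of "\<lambda>j. w ! (j - 1)" "[0 + 1..<n + 1]"]
    by (simp add: atLeastLessThanSuc_atLeastAtMost del: upt_Suc)
qed

lemma bij_betw_perm_mult:
  assumes "distinct w" "length w = n"
  shows "bij_betw (\<lambda>t. perm_mult t w) (perms n) (permutations_of_set (set w))"
proof -
  let ?f = "\<lambda>j. w ! (j - 1)"
  have inj_and_image: "inj_on ?f {1..n}" "?f ` {1..n} = set w"
    using bij_betw_nth_pred[OF assms] by (auto simp: bij_betw_def)
  have "inj_on (map ?f) (perms n)"
    by (rule inj_on_mapI) (rule inj_on_subset[OF inj_and_image(1)], auto simp: perms_def)
  moreover have "map ?f ` perms n = permutations_of_set (set w)"
    unfolding perms_eq inj_and_image(2)[symmetric]
    by (rule permutations_of_set_image_inj[OF inj_and_image(1), symmetric])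
  ultimately show ?thesis
    unfolding bij_betw_def perm_mult_def by simp
qed

lemma perm_mult_in_perms:
  assumes "u \<in> perms n" "v \<in> perms n"
  shows "perm_mult u v \<in> perms n"
  using bij_betwE[OF bij_betw_perm_mult[of v n]] assms length_perms[OF assms(2)]
  by (auto simp: perms_eq permutations_of_set_def)

lemma perm_mult_assoc:
  assumes "u \<in> perms n" "v \<in> perms n"
  shows "perm_mult (perm_mult u v) w = perm_mult u (perm_mult v w)"
proof -
  have "j - 1 < length v" if "j \<in> set u" for j
    using that assms length_perms[OF assms(2)] by (auto simp: perms_def)
  then show ?thesis by (auto simp: perm_mult_def)
qed

lemma act_eq_sum: "act n x w = (\<Sum>t\<in>perms n. scl (x t) (delta (perm_mult t w)))"
  by (rule ext) (auto simp: act_def perm_mult_def sum_comb_apply delta_def intro!: sum.cong)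

lemma conv_eq_sum: "conv n x y = (\<Sum>v\<in>perms n. scl (y v) (act n x v))"
  unfolding conv_def act_def perm_mult_def
  by (subst sum.swap) (auto simp: fun_eq_iff sum_comb_apply sum_distrib_left intro!: sum.cong)

lemma comb_linear_conv: "comb_linear (conv n x)"
  unfolding conv_eq_sum
  by (rule comb_linearI)
    (simp_all only: plus_fun_apply scl_apply comb.scale_left_distrib sum.distrib
        comb.scale_sum_right
      flip: comb.scale_scale)

lemma lin_ext_act: "lin_ext f (act n x w) = (\<Sum>t\<in>perms n. scl (x t) (f (perm_mult t w)))"
  unfolding act_eq_sum by (rule lin_ext_sum_delta)

lemma conv_delta: "w \<in> perms n \<Longrightarrow> conv n x (delta w) = act n x w"
  unfolding conv_eq_sum by (subst sum.remove[of _ w]) (auto simp: delta_def intro!: sum.neutral)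

lemma sum_conv:
  "(\<Sum>t\<in>perms n. scl (conv n x y t) (f t)) =
    (\<Sum>v\<in>perms n. \<Sum>u\<in>perms n. scl (y v * x u) (f (perm_mult u v)))"
proof -
  have "scl (conv n x y t) (f t) =
    (\<Sum>v\<in>perms n. \<Sum>u\<in>perms n. if perm_mult u v = t then scl (y v * x u) (f t) else 0)" for t
    unfolding conv_def
    by (subst sum.swap) (auto simp: comb.scale_sum_left mult.commute intro!: sum.cong)
  then have "(\<Sum>t\<in>perms n. scl (conv n x y t) (f t)) = (\<Sum>v\<in>perms n. \<Sum>u\<in>perms n. \<Sum>t\<in>perms n.
      if perm_mult u v = t then scl (y v * x u) (f t) else 0)"
    by (simp only:) (subst sum.swap, rule sum.cong[OF refl], rule sum.swap)
  also have "\<dots> = (\<Sum>v\<in>perms n. \<Sum>u\<in>perms n. scl (y v * x u) (f (perm_mult u v)))"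
    by (intro sum.cong refl) (simp add: perm_mult_in_perms)
  finally show ?thesis .
qed

lemma act_conv: "act n (conv n x y) w = lin_ext (act n x) (act n y w)"
proof -
  have "act n (conv n x y) w =
    (\<Sum>v\<in>perms n. \<Sum>u\<in>perms n. scl (y v * x u) (delta (perm_mult u (perm_mult v w))))"
    unfolding act_eq_sum sum_conv by (intro sum.cong refl) (simp add: perm_mult_assoc)
  also have "\<dots> = (\<Sum>v\<in>perms n. scl (y v) (act n x (perm_mult v w)))"
    by (simp only: act_eq_sum comb.scale_sum_right comb.scale_scale)
  finally show ?thesis by (simp only: lin_ext_act)
qed

lemma act_delta: "t \<in> perms n \<Longrightarrow> act n (delta t) w = delta (perm_mult t w)"
  unfolding act_eq_sum
  by (subst sum.remove[of _ t]) (auto simp: delta_def[of t] intro!: sum.neutral)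

lemma act_one:
  assumes "length w = n"
  shows "act n (one n) w = delta w"
proof -
  have "[1..<n + 1] \<in> perms n" by (auto simp: perms_def)
  moreover have "perm_mult [1..<n + 1] w = w"
    using map_nth_upt[of n w 0] assms by (simp add: perm_mult_def)
  ultimately show ?thesis by (simp add: one_def act_delta)
qed

lemma act_diff: "act n (x - y) w = act n x w - act n y w"
  by (simp only: act_eq_sum minus_apply comb.scale_left_diff_distrib sum_subtractf)

lemma act_prodl_Cons: "act n (prodl n (x # xs)) w = lin_ext (act n x) (act n (prodl n xs) w)"
  by (simp add: prodl_def act_conv)

lemma lin_ext_delta_append:
  assumes "finite_support x"
  shows "lin_ext (\<lambda>u. delta (a @ u @ b)) x = cat (delta a) (cat x (delta b))"
  using assms cat_lin_ext_left[of delta x "delta b"]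
  by (simp add: lin_ext_delta_fun cat_lin_ext_right cat_delta_delta)

subsection \<open>The Dynkin operator\<close>

lemma act_one_minus_cyc:
  assumes "m = length (u @ b # v)"
  shows "act m (one m - delta (cyc m (Suc (length u)))) (u @ b # v) =
      delta (u @ b # v) - delta (b # u @ v)"
proof -
  have "cyc m (Suc (length u)) \<in> perms m" using assms by (auto simp: cyc_def perms_def)
  moreover have "perm_mult (cyc m (Suc (length u))) (u @ b # v) = b # u @ v"
    using map_nth_upt[of "length u" "u @ b # v" 0]
      map_nth_upt[of m "u @ b # v" "Suc (length u)"] assms
    by (simp add: perm_mult_def cyc_def)
  ultimately show ?thesis using assms by (simp only: act_diff act_one act_delta)
qed

lemma act_omega_partial:
  assumes "length w = m" "1 \<le> k" "k \<le> m"
  shows "act m (prodl m (map (\<lambda>i. one m - delta (cyc m i)) (rev [2..<k + 1]))) w =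
    (cat (left_normed (take k w)) (delta (drop k w)) :: 'a::field comb)"
  using assms(2,3)
proof (induction k rule: dec_induct)
  case base
  then obtain a u where "w = a # u" using assms(1) by (cases w) auto
  then show ?case using assms(1) by (simp add: prodl_def act_one cat_delta_delta)
next
  case (step k)
  let ?u = "take k w" and ?b = "w ! k" and ?v = "drop (Suc k) w"
  let ?X = "\<lambda>k. prodl m (map (\<lambda>i. one m - delta (cyc m i)) (rev [2..<k + 1])) :: 'a comb"
  let ?c = "one m - delta (cyc m (Suc k)) :: 'a comb"
  have lengths: "length ?u = k" "length ?v = m - Suc k" and nonempty: "?u \<noteq> []"
    using step.prems step.hyps assms(1) by auto
  have "act m (?X (Suc k)) w = lin_ext (act m ?c) (act m (?X k) w)"
    using step.hyps by (simp add: act_prodl_Cons)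
  also have "act m (?X k) w = cat (left_normed ?u) (delta (drop k w))"
    using step.prems by (intro step.IH) simp
  also have "drop k w = ?b # ?v"
    using step.prems assms(1) by (simp add: Cons_nth_drop_Suc)
  also have "lin_ext (act m ?c) (cat (left_normed ?u) (delta (?b # ?v))) =
    lin_ext (\<lambda>u. act m ?c (u @ ?b # ?v)) (left_normed ?u)"
    by (simp add: lin_ext_cat)
  also have "\<dots> = lin_ext (\<lambda>u. delta ([] @ u @ ?b # ?v) - delta ([?b] @ u @ ?v)) (left_normed ?u)"
  proof (rule lin_ext_cong)
    fix u assume "left_normed ?u u \<noteq> (0 :: 'a)"
    from left_normed_nonzeroD[OF this, THEN mset_eq_length] have "length u = k"
      using lengths(1) by simp
    then show "act m ?c (u @ ?b # ?v) = delta ([] @ u @ ?b # ?v) - delta ([?b] @ u @ ?v)"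
      using act_one_minus_cyc[of m u ?b ?v] lengths(2) step.prems by simp
  qed
  also have "\<dots> = cat (left_normed ?u) (delta (?b # ?v)) -
      cat (delta [?b]) (cat (left_normed ?u) (delta ?v))"
    by (simp only: lin_ext_diff_fun lin_ext_delta_append finite_support_left_normed
      cat_delta_Nil_left)
  also have "\<dots> = cat (bracket (left_normed ?u) (delta [?b])) (delta ?v)"
    by (simp add: bracket_def cat_diff_left cat_assoc cat_delta_delta)
  also have "bracket (left_normed ?u) (delta [?b]) = left_normed (take (Suc k) w)"
    using step.prems assms(1) nonempty by (simp add: take_Suc_conv_app_nth left_normed_snoc)
  finally show ?case .
qed

lemma Qw_eq_left_normed: "Qw w = left_normed w"
proof (cases "w = []")
  case True
  then show ?thesis by (simp add: Qw_def omega_def prodl_def act_one)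
next
  case False
  then have "length w \<ge> 1" by (cases w) auto
  then show ?thesis
    using act_omega_partial[of w "length w" "length w"] by (simp add: Qw_def omega_def)
qed

lemma QT_eq_left_normed_prod: "QT Ts = left_normed_prod Ts"
  by (simp add: QT_def left_normed_prod_def Qw_eq_left_normed)

lemma shiftw_in_perms:
  assumes "s \<in> perms m" "r + m \<le> n"
  shows "shiftw n r s \<in> perms n"
proof -
  have s: "distinct s" "set s = {1..m}" "length s = m"
    using assms length_perms by (auto simp: perms_def)
  have "set (map (\<lambda>j. j + r) s) = {r + 1..r + m}"
    using s(2) by (simp add: add.commute[of _ r] image_add_atLeastAtMost)
  moreover have "distinct (map (\<lambda>j. j + r) s)" using s by (simp add: distinct_map)
  ultimately show ?thesis using assms(2) s(3) unfolding shiftw_def perms_def by auto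
qed

lemma perm_mult_shiftw:
  assumes "s \<in> perms (length b)"
  shows "perm_mult (shiftw (length (a @ b @ c)) (length a) s) (a @ b @ c) = a @ perm_mult s b @ c"
proof -
  have s: "set s = {1..length b}" "length s = length b"
    using assms length_perms by (auto simp: perms_def)
  have "map (\<lambda>j. (a @ b @ c) ! (j - 1)) [0 + 1..<length a + 1] = a"
    by (subst map_nth_upt) auto
  moreover have "map (\<lambda>j. (a @ b @ c) ! (j - 1))
      [(length a + length b) + 1..<length (a @ b @ c) + 1] = c"
    by (subst map_nth_upt) auto
  moreover have "map (\<lambda>j. (a @ b @ c) ! (j + length a - 1)) s = map (\<lambda>j. b ! (j - 1)) s"
  proof (rule map_cong[OF refl])
    fix j assume "j \<in> set s"
    then have "j + length a - 1 = length a + (j - 1)" "j - 1 < length b" using s by auto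
    then show "(a @ b @ c) ! (j + length a - 1) = b ! (j - 1)" by (simp add: nth_append)
  qed
  ultimately show ?thesis by (simp add: perm_mult_def shiftw_def s o_def add.assoc)
qed

lemma act_shift:
  assumes "n = length (a @ b @ c)"
  shows "act n (shift n (length a) (length b) x) (a @ b @ c) =
    cat (delta a) (cat (act (length b) x b) (delta c))"
proof -
  let ?w = "a @ b @ c" and ?S = "perms (length b)"
  have "scl (shift n (length a) (length b) x t) (delta (perm_mult t ?w)) =
    (\<Sum>s\<in>?S. if shiftw n (length a) s = t then scl (x s) (delta (perm_mult t ?w)) else 0)" for t
    by (auto simp: shift_def comb.scale_sum_left intro!: sum.cong)
  then have "act n (shift n (length a) (length b) x) ?w = (\<Sum>s\<in>?S. \<Sum>t\<in>perms n.
      if shiftw n (length a) s = t then scl (x s) (delta (perm_mult t ?w)) else 0)"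
    by (simp only: act_eq_sum) (rule sum.swap)
  also have "\<dots> = (\<Sum>s\<in>?S. scl (x s) (delta (a @ perm_mult s b @ c)))"
    using perm_mult_shiftw[of _ b a c] assms by (intro sum.cong refl) (simp add: shiftw_in_perms)
  also have "\<dots> = cat (delta a) (cat (act (length b) x b) (delta c))"
    by (simp only: act_eq_sum cat_sum_left cat_sum_right cat_scl_left cat_scl_right cat_delta_delta)
  finally show ?thesis .
qed

lemma act_omega_up_partial:
  assumes "i \<le> length us" "n = length (concat us)"
  defines "q \<equiv> map length us"
  shows "act n (prodl n (map (\<lambda>j. shift n (psum q j) (q ! j) (omega (q ! j))) [i..<length us]))
      (concat us) =
    (cat (delta (concat (take i us))) (left_normed_prod (drop i us)) :: 'a::field comb)"
  using assms(1)
proof (induction i rule: inc_induct)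
  case base
  then show ?case using assms(2) by (simp add: prodl_def act_one)
next
  case (step i)
  let ?Y = "\<lambda>j. shift n (psum q j) (q ! j) (omega (q ! j)) :: 'a comb"
  let ?a = "concat (take i us)" and ?b = "us ! i" and ?R = "drop (Suc i) us"
  have "us = take i us @ ?b # ?R" using step.hyps by (simp add: id_take_nth_drop)
  then have "n = length ?a + length ?b + length (concat ?R)"
    by (metis assms(2) concat.simps(2) concat_append length_append add.assoc)
  moreover have "psum q i = length ?a" "q ! i = length ?b"
    using step.hyps by (simp_all add: q_def psum_def length_concat take_map)
  ultimately have act_factor: "act n (?Y i) (?a @ ?b @ v) =
      cat (delta ?a) (cat (left_normed ?b) (delta v))"
    if "left_normed_prod ?R v \<noteq> (0 :: 'a)" for v
    using left_normed_prod_nonzeroD[OF that, THEN mset_eq_length]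
      Qw_eq_left_normed[of ?b, where ?'a = 'a]
    by (simp add: act_shift Qw_def)
  have "act n (prodl n (map ?Y [i..<length us])) (concat us) =
    lin_ext (act n (?Y i)) (cat (delta (?a @ ?b)) (left_normed_prod ?R))"
    using step by (simp add: upt_conv_Cons act_prodl_Cons take_Suc_conv_app_nth)
  also have "\<dots> = lin_ext (\<lambda>v. act n (?Y i) (?a @ ?b @ v)) (left_normed_prod ?R)"
    by (simp add: lin_ext_cat)
  also have "\<dots> = lin_ext (\<lambda>v. cat (delta ?a) (cat (left_normed ?b) (delta v))) (left_normed_prod ?R)"
    by (rule lin_ext_cong[OF act_factor])
  also have "\<dots> = cat (delta ?a) (cat (left_normed ?b) (left_normed_prod ?R))"
    by (simp add: lin_ext_delta_fun flip: cat_lin_ext_right)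
  finally show ?case using step.hyps by (simp flip: Cons_nth_drop_Suc)
qed

lemma act_omega_up:
  assumes "map length us = q" "n = sum_list q"
  shows "act n (omega_up n q) (concat us) = left_normed_prod us"
  using act_omega_up_partial[of 0 us n] assms by (auto simp: omega_up_def length_concat)

section \<open>Splitting words along a composition\<close>

fun blocks :: "nat list \<Rightarrow> 'b list \<Rightarrow> 'b list list" where
  "blocks [] w = []"
| "blocks (m # q) w = take m w # blocks q (drop m w)"

lemma concat_blocks: "length w = sum_list q \<Longrightarrow> concat (blocks q w) = w"
  by (induction q arbitrary: w) auto

lemma map_length_blocks: "length w = sum_list q \<Longrightarrow> map length (blocks q w) = q"
  by (induction q arbitrary: w) auto

lemma blocks_map: "blocks q (map f w) = map (map f) (blocks q w)"
  by (induction q arbitrary: w) (simp_all add: take_map drop_map)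

lemma blocks_concat: "blocks (map length us) (concat us) = us"
  by (induction us) simp_all

lemma zero_notin_descents [simp]: "0 \<notin> descents w"
  and Suc_in_descents_iff [simp]: "Suc i \<in> descents w \<longleftrightarrow> Suc i < length w \<and> w ! Suc i < w ! i"
  by (auto simp: descents_def)

lemma descents_append:
  "descents (a @ b) - {length a} = descents a \<union> (+) (length a) ` descents b"
proof (rule set_eqI)
  fix i
  consider (zero) "i = 0" | (left) k where "i = Suc k" "Suc k < length a"
    | (boundary) "i = length a" | (right) j where "i = length a + Suc j"
    using less_imp_Suc_add[of "length a" i] by (metis add_Suc_right less_linear not0_implies_Suc)
  then show "i \<in> descents (a @ b) - {length a} \<longleftrightarrow> i \<in> descents a \<union> (+) (length a) ` descents b"
  proof cases
    case boundary
    then show ?thesis by (auto simp: descents_def)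
  next
    case (right j)
    have "i \<notin> descents a" using right by (simp add: descents_def)
    moreover have "i \<in> descents (a @ b) \<longleftrightarrow> Suc j \<in> descents b"
      using right by (simp add: nth_append)
    ultimately show ?thesis using right by auto
  qed (auto simp: nth_append image_iff)
qed

lemma descents_empty_iff: "descents w = {} \<longleftrightarrow> sorted w"
proof -
  have "descents w = {} \<longleftrightarrow> (\<forall>i. Suc i \<notin> descents w)"
    by (metis all_not_in_conv not0_implies_Suc zero_notin_descents)
  then show ?thesis by (simp add: sorted_iff_nth_Suc) (meson linorder_not_less)
qed

lemma psum_set_Cons:
  "{psum (m # q) j | j. 1 \<le> j \<and> j \<le> length (m # q)} =
    insert m ((+) m ` {psum q j | j. 1 \<le> j \<and> j \<le> length q})"
proof -
  have psums: "{psum q j | j. 1 \<le> j \<and> j \<le> length q} = psum q ` {1..length q}" for q by auto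
  have "{1..length (m # q)} = Suc ` insert 0 {1..length q}"
    by (simp add: atLeastAtMost_insertL)
  moreover have "psum (m # q) (Suc j) = m + psum q j" "psum q 0 = 0" for j
    by (simp_all add: psum_def)
  ultimately show ?thesis unfolding psums by (simp add: image_image del: image_Suc_atLeastAtMost)
qed

lemma descents_subset_psums_iff:
  assumes "length w = sum_list q"
  shows "descents w \<subseteq> {psum q j | j. 1 \<le> j \<and> j \<le> length q} \<longleftrightarrow> (\<forall>b\<in>set (blocks q w). sorted b)"
  using assms
proof (induction q arbitrary: w)
  case Nil
  then show ?case by (auto simp: descents_def)
next
  case (Cons m q)
  let ?a = "take m w" and ?b = "drop m w"
  let ?P = "{psum q j | j. 1 \<le> j \<and> j \<le> length q}"
  have descents_Diff: "descents w - {m} = descents ?a \<union> (+) m ` descents ?b"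
    using descents_append[of ?a ?b] Cons.prems by simp
  have "\<forall>i\<in>descents ?a. i < m" by (auto simp: descents_def)
  then have take_iff: "descents ?a \<subseteq> (+) m ` ?P \<longleftrightarrow> descents ?a = {}" by fastforce
  have drop_iff: "(+) m ` descents ?b \<subseteq> (+) m ` ?P \<longleftrightarrow> descents ?b \<subseteq> ?P"
    by (rule inj_image_subset_iff) simp
  have "descents w \<subseteq> insert m ((+) m ` ?P) \<longleftrightarrow> descents w - {m} \<subseteq> (+) m ` ?P" by blast
  also have "\<dots> \<longleftrightarrow> sorted ?a \<and> descents ?b \<subseteq> ?P"
    unfolding descents_Diff Un_subset_iff take_iff drop_iff descents_empty_iff ..
  finally show ?case
    unfolding psum_set_Cons using Cons by simp
qed

lemma sorted_iff_subseq_map_nth: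
  assumes "distinct w" "distinct js" "set js \<subseteq> {1..length w}"
  shows "sorted js \<longleftrightarrow> subseq (map (\<lambda>j. w ! (j - 1)) js) w"
proof -
  let ?f = "\<lambda>j. w ! (j - 1)" and ?n = "length w"
  have w: "map ?f [1..<?n + 1] = w" using map_nth_upt[of ?n w 0] by simp
  show ?thesis
  proof
    assume "sorted js"
    then have "subseq js [1..<?n + 1]"
      using assms(2,3)
      by (intro sorted_subset_imp_subseq) (auto simp: strict_sorted_iff simp del: upt_Suc)
    then show "subseq (map ?f js) w" using subseq_map w by metis
  next
    assume "subseq (map ?f js) w"
    then have sub: "subseq (map ?f js) (map ?f [1..<?n + 1])" using w by simp
    define g where "g = the_inv_into {1..?n} ?f"
    have "g (?f j) = j" if "j \<in> {1..?n}" for j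
      unfolding g_def
      using bij_betw_imp_inj_on[OF bij_betw_nth_pred[OF assms(1) refl]] that
      by (rule the_inv_into_f_f)
    then have "map g (map ?f ks) = ks" if "set ks \<subseteq> {1..?n}" for ks
      using that by (simp only: map_map o_def) (blast intro: map_idI)
    then have "map g (map ?f js) = js" "map g (map ?f [1..<?n + 1]) = [1..<?n + 1]"
      using assms(3) by (simp_all only: set_upt atLeastLessThanSuc_atLeastAtMost
        Suc_eq_plus1[symmetric] order_refl)
    then have "subseq js [1..<?n + 1]" using subseq_map[OF sub, of g] by simp
    then show "sorted js"
      by (metis subseq_conv_nths sorted_nths sorted_upt)
  qed
qed

lemma sorted_blocks_iff_subseq:
  assumes "w \<in> perms n" "s \<in> perms n" "n = sum_list q"
  shows "(\<forall>b\<in>set (blocks q s). sorted b) \<longleftrightarrow> (\<forall>u\<in>set (blocks q (perm_mult s w)). subseq u w)"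
proof -
  have w: "distinct w" "length w = n" using assms(1) length_perms by (auto simp: perms_def)
  have "concat (blocks q s) = s" using assms(2,3) length_perms by (intro concat_blocks) simp
  then have "distinct (concat (blocks q s))" "set (concat (blocks q s)) = {1..n}"
    using assms(2) by (simp_all add: perms_def)
  then have "sorted b \<longleftrightarrow> subseq (map (\<lambda>j. w ! (j - 1)) b) w" if "b \<in> set (blocks q s)" for b
    using that w by (intro sorted_iff_subseq_map_nth) (auto simp: distinct_concat_iff)
  then show ?thesis by (simp add: perm_mult_def blocks_map)
qed

lemma bij_betw_unshuffles:
  assumes w: "w \<in> perms n" and n: "n = sum_list q"
  shows "bij_betw (\<lambda>s. blocks q (perm_mult s w))
    {s \<in> perms n. \<forall>b\<in>set (blocks q s). sorted b} (unshuffles q w)"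
    (is "bij_betw ?c ?S _")
proof (rule bij_betw_imageI)
  have distinct: "distinct w" using w by (simp add: perms_def)
  note bij = bij_betw_perm_mult[OF distinct length_perms[OF w]]
  have length_perm_mult: "length (perm_mult s w) = sum_list q" if "s \<in> perms n" for s
    using length_perms[OF that] n by (simp add: perm_mult_def)
  show "inj_on ?c ?S"
  proof (rule inj_onI)
    fix s t assume "s \<in> ?S" "t \<in> ?S" and same_blocks: "?c s = ?c t"
    then have in_perms: "s \<in> perms n" "t \<in> perms n" by simp_all
    then have "perm_mult s w = perm_mult t w"
      using arg_cong[OF same_blocks, of concat] by (simp only: concat_blocks[OF length_perm_mult])
    then show "s = t" using inj_onD[OF bij_betw_imp_inj_on[OF bij]] in_perms by blast
  qed
  show "?c ` ?S = unshuffles q w"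
  proof (intro set_eqI iffI)
    fix us assume "us \<in> ?c ` ?S"
    then obtain s where s: "s \<in> perms n" "us = ?c s" "\<forall>u\<in>set us. subseq u w"
      using sorted_blocks_iff_subseq[OF w _ n] by blast
    have "perm_mult s w \<in> permutations_of_set (set w)"
      using bij_betwE[OF bij] s(1) by blast
    then have "mset (perm_mult s w) = mset w"
      using distinct set_eq_iff_mset_eq_distinct by (auto simp: permutations_of_set_def)
    then show "us \<in> unshuffles q w"
      using s by (simp add: unshuffles_def map_length_blocks[OF length_perm_mult]
        concat_blocks[OF length_perm_mult])
  next
    fix us assume us: "us \<in> unshuffles q w"
    then have "concat us \<in> permutations_of_set (set w)"
      using distinct mset_eq_setD mset_eq_imp_distinct_iff
      unfolding unshuffles_def permutations_of_set_def by blast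
    then obtain s where s: "s \<in> perms n" "perm_mult s w = concat us"
      using bij_betw_imp_surj_on[OF bij] by (metis imageE)
    then have "?c s = us" using us blocks_concat[of us] by (simp add: unshuffles_def)
    then show "us \<in> ?c ` ?S"
      using us s(1) sorted_blocks_iff_subseq[OF w s(1) n]
      unfolding unshuffles_def by (intro image_eqI[of _ _ s]) simp_all
  qed
qed

theorem act_omega_q:
  assumes "w \<in> perms n" "n = sum_list q"
  shows "act n (omega_q n q) w = (dynkin_conv q w :: 'a::field comb)"
proof -
  let ?P = "{s \<in> perms n. \<forall>b\<in>set (blocks q s). sorted b}"
  have "act n (omega_q n q) w =
      (\<Sum>s\<in>perms n. scl (Xi n q s) (act n (omega_up n q) (perm_mult s w)) :: 'a comb)"
    by (simp only: omega_q_def act_conv lin_ext_act)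
  also have "\<dots> = (\<Sum>s\<in>perms n.
      if \<forall>b\<in>set (blocks q s). sorted b then left_normed_prod (blocks q (perm_mult s w)) else 0)"
  proof (rule sum.cong[OF refl])
    fix s assume s: "s \<in> perms n"
    then have len: "length s = sum_list q" "length (perm_mult s w) = sum_list q"
      using length_perms assms(2) by (simp_all add: perm_mult_def)
    show "scl (Xi n q s) (act n (omega_up n q) (perm_mult s w)) =
      (if \<forall>b\<in>set (blocks q s). sorted b
        then left_normed_prod (blocks q (perm_mult s w)) else 0 :: 'a comb)"
      using s act_omega_up[OF map_length_blocks[OF len(2)] assms(2), where ?'a = 'a]
        descents_subset_psums_iff[OF len(1)]
      by (simp add: Xi_def concat_blocks[OF len(2)])
  qed
  also have "\<dots> = (\<Sum>s\<in>?P. left_normed_prod (blocks q (perm_mult s w)))"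
    by (rule sum.inter_filter[symmetric]) simp
  also have "\<dots> = (\<Sum>us\<in>unshuffles q w. left_normed_prod us)"
    by (rule sum.reindex_bij_betw[OF bij_betw_unshuffles[OF assms]])
  finally show ?thesis
    using assms(1) by (simp add: dynkin_conv_eq_sum_unshuffles perms_def)
qed

lemma group_alg_eq_span: "(group_alg n :: 'a::field comb set) = comb.span (delta ` perms n)"
proof
  show "group_alg n \<subseteq> (comb.span (delta ` perms n) :: 'a comb set)"
  proof
    fix x :: "'a comb" assume "x \<in> group_alg n"
    then have "x = (\<Sum>w\<in>perms n. scl (x w) (delta w))"
      by (intro comb_eq_sum_delta) (auto simp: group_alg_def)
    then show "x \<in> comb.span (delta ` perms n)"
      by (rule ssubst) (intro comb.span_sum comb.span_scale comb.span_base imageI)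
  qed
  show "comb.span (delta ` perms n) \<subseteq> (group_alg n :: 'a comb set)"
    by (intro comb.span_minimal comb.subspaceI) (auto simp: group_alg_def delta_def)
qed

lemma Lie_eq_span:
  assumes "n = sum_list q"
  shows "Lie n q = comb.span (dynkin_conv q ` perms n)"
proof -
  have "Lie n q = conv n (omega_q n q) ` group_alg n" by (auto simp: Lie_def)
  also have "\<dots> = comb.span (conv n (omega_q n q) ` delta ` perms n)"
    by (simp only: group_alg_eq_span module_hom.span_image[OF comb_linear_conv])
  also have "conv n (omega_q n q) ` delta ` perms n = dynkin_conv q ` perms n"
    unfolding image_image by (rule image_cong) (simp_all add: conv_delta act_omega_q[OF _ assms])
  finally show ?thesis .
qed

lemma left_normed_prod_in_group_alg:
  assumes "concat us \<in> perms n"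
  shows "left_normed_prod us \<in> group_alg n"
proof -
  have "w \<in> perms n" if "left_normed_prod us w \<noteq> (0 :: 'a)" for w
    using assms perms_cong_mset[OF left_normed_prod_nonzeroD[OF that]] by simp
  then show ?thesis unfolding group_alg_def by blast
qed

section \<open>Partitions into words\<close>

definition word_partition_on :: "nat set \<Rightarrow> nat list set \<Rightarrow> bool" where
  "word_partition_on A S \<longleftrightarrow>
    finite S \<and> (\<forall>t\<in>S. min_first t) \<and> disjoint_family_on set S \<and> (\<Union>t\<in>S. set t) = A"

text \<open>The set \<open>\<Gamma>(\<lambda>(q))\<close> with the order of the words forgotten, for any finite set of letters.\<close>

definition word_partitions :: "nat set \<Rightarrow> nat list \<Rightarrow> nat list set set" where
  "word_partitions A q = {S. word_partition_on A S \<and> image_mset length (mset_set S) = mset q}"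

lemma word_partition_on_empty [simp]: "word_partition_on A {} \<longleftrightarrow> A = {}"
  by (auto simp: word_partition_on_def disjoint_family_on_def)

lemma word_partition_on_finite: "word_partition_on A S \<Longrightarrow> finite S"
  by (simp add: word_partition_on_def)

lemma word_partition_onD:
  assumes "word_partition_on A S" "t \<in> S"
  shows "min_first t" "t \<noteq> []" "distinct t" "set t \<subseteq> A"
  using assms by (auto simp: word_partition_on_def min_first_def)

lemma word_partition_on_disjoint:
  assumes "word_partition_on A S" "s \<in> S" "t \<in> S" "x \<in> set s" "x \<in> set t"
  shows "s = t"
  using assms unfolding word_partition_on_def disjoint_family_on_def by blast

lemma word_partition_on_insert:
  assumes "min_first t" "set t \<inter> A = {}" "word_partition_on A S"
  shows "t \<notin> S" "word_partition_on (set t \<union> A) (insert t S)"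
proof -
  have "hd t \<in> set t" using assms(1) by (simp add: min_first_def)
  then show "t \<notin> S" using assms(2) word_partition_onD(4)[OF assms(3)] by blast
  show "word_partition_on (set t \<union> A) (insert t S)"
    using assms unfolding word_partition_on_def disjoint_family_on_def by (auto 4 3)
qed

lemma word_partition_on_remove:
  assumes "word_partition_on A S" "t \<in> S"
  shows "word_partition_on (A - set t) (S - {t})"
  using assms unfolding word_partition_on_def disjoint_family_on_def by auto

lemma word_partitions_Nil [simp]: "word_partitions {} [] = {{}}"
proof -
  have "S = {}" if "word_partition_on {} S" for S
    using word_partition_onD(2,4)[OF that] by fastforce
  then show ?thesis by (auto simp: word_partitions_def)
qed

lemma finite_min_first_words: "finite A \<Longrightarrow> finite {t. min_first t \<and> set t \<subseteq> A}"
  by (rule finite_subset[OF _ finite_subset_distinct[of A]]) (auto simp: min_first_def)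

lemma finite_word_partitions: "finite A \<Longrightarrow> finite (word_partitions A q)"
  by (rule finite_subset[OF _ finite_Pow_iff[THEN iffD2, OF finite_min_first_words[of A]]])
    (auto simp: word_partitions_def word_partition_on_def)

lemma word_partitions_insert:
  assumes "min_first t" "set t \<subseteq> A" "S \<in> word_partitions (A - set t) q"
  shows "t \<notin> S" "insert t S \<in> word_partitions A (length t # q)"
proof -
  have S: "word_partition_on (A - set t) S" "finite S" "image_mset length (mset_set S) = mset q"
    using assms(3) by (auto simp: word_partitions_def word_partition_on_def)
  note ins = word_partition_on_insert[OF assms(1) Diff_disjoint S(1)]
  show "t \<notin> S" by (rule ins)
  moreover have "set t \<union> (A - set t) = A" using assms(2) by blast
  ultimately show "insert t S \<in> word_partitions A (length t # q)"
    using ins(2) S by (simp add: word_partitions_def)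
qed

lemma word_partitions_remove:
  assumes "S \<in> word_partitions A (length t # q)" "t \<in> S"
  shows "S - {t} \<in> word_partitions (A - set t) q"
proof -
  have "word_partition_on A S" "finite S" "image_mset length (mset_set S) = mset (length t # q)"
    using assms(1) by (auto simp: word_partitions_def word_partition_on_def)
  then show ?thesis
    using mset_set.remove[of S t] assms(2) word_partition_on_remove
    by (simp add: word_partitions_def)
qed

lemma card_min_first_permutations:
  assumes "finite B" "B \<noteq> {}"
  shows "card {t \<in> permutations_of_set B. min_first t} = fact (card B - 1)"
proof -
  have "{t \<in> permutations_of_set B. min_first t} = (#) (Min B) ` permutations_of_set (B - {Min B})"
  proof (intro set_eqI iffI)
    fix t assume t: "t \<in> {t \<in> permutations_of_set B. min_first t}"
    then obtain u where "t = Min B # u"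
      by (cases t) (auto simp: min_first_def permutations_of_set_def)
    then show "t \<in> (#) (Min B) ` permutations_of_set (B - {Min B})"
      using t by (auto simp: permutations_of_set_def)
  next
    fix t assume "t \<in> (#) (Min B) ` permutations_of_set (B - {Min B})"
    then obtain u where u: "t = Min B # u" "set u = B - {Min B}" "distinct u"
      by (auto simp: permutations_of_set_def)
    moreover have "set t = B" using u Min_in[OF assms] by auto
    ultimately show "t \<in> {t \<in> permutations_of_set B. min_first t}"
      by (simp add: min_first_def permutations_of_set_def)
  qed
  then show ?thesis using assms by (simp add: card_image)
qed

lemma card_min_first_words:
  assumes "finite A" "m > 0"
  shows "card {t. min_first t \<and> set t \<subseteq> A \<and> length t = m} = (card A choose m) * fact (m - 1)"
proof -
  let ?B = "{B. B \<subseteq> A \<and> card B = m}" and ?M = "\<lambda>B. {t \<in> permutations_of_set B. min_first t}"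
  have finite_subsets: "finite ?B" by (rule finite_subset[of _ "Pow A"]) (use assms in auto)
  have card_fibre: "card (?M B) = fact (m - 1)" if "B \<in> ?B" for B
    using that assms card_min_first_permutations[of B] finite_subset[of B A] by fastforce
  have "bij_betw snd (SIGMA B:?B. ?M B) {t. min_first t \<and> set t \<subseteq> A \<and> length t = m}"
    by (rule bij_betw_byWitness[where f' = "\<lambda>t. (set t, t)"])
      (auto simp: permutations_of_set_def min_firstD distinct_card)
  then have "card {t. min_first t \<and> set t \<subseteq> A \<and> length t = m} = card (SIGMA B:?B. ?M B)"
    by (rule bij_betw_same_card[symmetric])
  also have "\<dots> = (\<Sum>B\<in>?B. card (?M B))"
    using finite_subsets by (intro card_SigmaI) simp_all
  also have "\<dots> = (\<Sum>B\<in>?B. fact (m - 1))"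
    by (rule sum.cong[OF refl card_fibre])
  finally show ?thesis by (simp add: n_subsets[OF assms(1)])
qed

lemma card_words_of_length:
  assumes "S \<in> word_partitions A q"
  shows "card {t \<in> S. length t = m} = count_list q m"
proof -
  have S: "finite S" "image_mset length (mset_set S) = mset q"
    using assms by (auto simp: word_partitions_def word_partition_on_finite)
  have "card {t \<in> S. length t = m} = count (image_mset length (mset_set S)) m"
    using S(1) by (auto simp: count_image_mset intro!: arg_cong[of _ _ card])
  then show ?thesis by (simp add: S(2) count_mset)
qed

lemma bij_betw_remove_word:
  "bij_betw (\<lambda>(S, t). (t, S - {t})) (SIGMA S:word_partitions A (m # q). {t \<in> S. length t = m})
    (SIGMA t:{t. min_first t \<and> set t \<subseteq> A \<and> length t = m}. word_partitions (A - set t) q)"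
    (is "bij_betw ?f ?W ?M")
proof (rule bij_betw_byWitness[where f' = "\<lambda>(t, S). (insert t S, t)"])
  show "\<forall>p\<in>?W. (case ?f p of (t, S) \<Rightarrow> (insert t S, t)) = p"
    by auto
  show "\<forall>p\<in>?M. ?f (case p of (t, S) \<Rightarrow> (insert t S, t)) = p"
    by (auto dest: word_partitions_insert(1))
  show "?f ` ?W \<subseteq> ?M"
  proof (rule image_subsetI)
    fix p assume "p \<in> ?W"
    then obtain S t where p: "p = (S, t)" and S: "S \<in> word_partitions A (length t # q)"
      and t: "t \<in> S" "length t = m" by auto
    from S have "word_partition_on A S" by (simp add: word_partitions_def)
    then have "min_first t \<and> set t \<subseteq> A" using t word_partition_onD(1,4) by blast
    then show "?f p \<in> ?M"
      using t word_partitions_remove[OF S t(1)] by (simp add: p)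
  qed
  show "(\<lambda>(t, S). (insert t S, t)) ` ?M \<subseteq> ?W"
    using word_partitions_insert(2) by auto
qed

lemma card_word_partitions_Cons:
  assumes "finite A"
  shows "Suc (count_list q m) * card (word_partitions A (m # q)) =
    (\<Sum>t | min_first t \<and> set t \<subseteq> A \<and> length t = m. card (word_partitions (A - set t) q))"
proof -
  let ?W = "SIGMA S:word_partitions A (m # q). {t \<in> S. length t = m}"
  let ?M = "{t. min_first t \<and> set t \<subseteq> A \<and> length t = m}"
  have "finite {t \<in> S. length t = m}" if "S \<in> word_partitions A (m # q)" for S
    using that word_partition_on_finite[of A S] by (simp add: word_partitions_def)
  then have "card ?W = (\<Sum>S\<in>word_partitions A (m # q). card {t \<in> S. length t = m})"
    by (intro card_SigmaI ballI finite_word_partitions[OF assms])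
  also have "\<dots> = (\<Sum>S\<in>word_partitions A (m # q). count_list (m # q) m)"
    by (rule sum.cong[OF refl card_words_of_length])
  finally have "Suc (count_list q m) * card (word_partitions A (m # q)) = card ?W" by simp
  also have "\<dots> = card (SIGMA t:?M. word_partitions (A - set t) q)"
    by (rule bij_betw_same_card[OF bij_betw_remove_word])
  also have "\<dots> = (\<Sum>t\<in>?M. card (word_partitions (A - set t) q))"
    by (intro card_SigmaI ballI finite_word_partitions
      finite_subset[OF _ finite_min_first_words[OF assms]])
      (use assms in auto)
  finally show ?thesis .
qed

lemma qq_superset:
  assumes "finite I" "set q \<subseteq> I"
  shows "qq q = (\<Prod>i\<in>I. i ^ count_list q i * fact (count_list q i))"
  unfolding qq_def by (rule prod.mono_neutral_left) (use assms in auto)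

lemma qq_Cons: "qq (m # q) = m * Suc (count_list q m) * qq q"
proof -
  let ?I = "insert m (set q)"
  let ?f = "\<lambda>q i. i ^ count_list q i * fact (count_list q i)"
  have "(\<Prod>i\<in>?I - {m}. ?f (m # q) i) = (\<Prod>i\<in>?I - {m}. ?f q i)"
    by (rule prod.cong) auto
  then have "qq (m # q) = ?f (m # q) m * (\<Prod>i\<in>?I - {m}. ?f q i)"
    using qq_superset[of ?I "m # q"] prod.remove[of ?I m "?f (m # q)"] by simp
  also have "\<dots> = m * Suc (count_list q m) * (?f q m * (\<Prod>i\<in>?I - {m}. ?f q i))"
    by (simp add: algebra_simps)
  also have "?f q m * (\<Prod>i\<in>?I - {m}. ?f q i) = qq q"
    using qq_superset[of ?I q] prod.remove[of ?I m "?f q"] by (simp add: subset_insertI)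
  finally show ?thesis .
qed

lemma card_word_partitions_mult_qq:
  assumes "finite A" "0 \<notin> set q" "sum_list q = card A"
  shows "card (word_partitions A q) * qq q = fact (card A)"
  using assms
proof (induction q arbitrary: A)
  case Nil
  then have "A = {}" by simp
  then show ?case by (simp add: qq_def)
next
  case (Cons m q)
  have m: "m > 0" "m \<le> card A" using Cons.prems by auto
  have "card (word_partitions (A - set t) q) * qq q = fact (card A - m)"
    if "min_first t" "set t \<subseteq> A" "length t = m" for t
    using Cons.IH[of "A - set t"] Cons.prems that
    by (auto simp: card_Diff_subset distinct_card min_first_def)
  then have "Suc (count_list q m) * card (word_partitions A (m # q)) * qq q =
    (card A choose m) * fact (m - 1) * fact (card A - m)"
    unfolding card_word_partitions_Cons[OF Cons.prems(1)]
    by (simp add: sum_distrib_right card_min_first_words[OF Cons.prems(1) m(1)])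
  then have "card (word_partitions A (m # q)) * qq (m # q) =
    (card A choose m) * (m * fact (m - 1)) * fact (card A - m)"
    by (simp only: qq_Cons mult_ac)
  also have "m * fact (m - 1) = (fact m :: nat)" using m(1) by (simp add: fact_reduce)
  also have "(card A choose m) * fact m * fact (card A - m) = fact (card A)"
    using binomial_fact_lemma[OF m(2)] by (simp add: mult_ac)
  finally show ?case .
qed

theorem card_word_partitions:
  assumes "finite A" "0 \<notin> set q" "sum_list q = card A"
  shows "card (word_partitions A q) = fact (card A) div qq q"
proof -
  have "card (word_partitions A q) * qq q = fact (card A)"
    by (rule card_word_partitions_mult_qq[OF assms])
  moreover from this have "qq q \<noteq> 0" by (metis fact_nonzero mult_0_right)
  ultimately show ?thesis by (metis nonzero_mult_div_cancel_right)
qed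

section \<open>Cycle decompositions\<close>

definition is_cycle :: "(nat \<Rightarrow> nat) \<Rightarrow> nat list \<Rightarrow> bool" where
  "is_cycle f t \<longleftrightarrow> map f t = rotate1 t"

lemma is_cycle_cong: "(\<And>x. x \<in> set t \<Longrightarrow> f x = g x) \<Longrightarrow> is_cycle f t \<longleftrightarrow> is_cycle g t"
  by (simp add: is_cycle_def cong: map_cong)

lemma is_cycle_funpow: "is_cycle f t \<Longrightarrow> map (f ^^ k) t = rotate k t"
proof (induction k)
  case (Suc k)
  have "map (f ^^ Suc k) t = map f (map (f ^^ k) t)" by simp
  also have "\<dots> = rotate k (map f t)" using Suc by (simp add: rotate_map)
  also have "\<dots> = rotate (Suc k) t"
    using Suc.prems by (simp add: is_cycle_def rotate1_rotate_swap)
  finally show ?case .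
qed simp

lemma is_cycle_orbit:
  assumes "is_cycle f t" "x \<in> set t"
  shows "{(f ^^ k) x | k. True} = set t"
proof -
  obtain i where i: "i < length t" "t ! i = x" using assms(2) by (auto simp: in_set_conv_nth)
  have iter: "(f ^^ k) x = t ! ((k + i) mod length t)" for k
    using arg_cong[OF is_cycle_funpow[OF assms(1), of k], of "\<lambda>s. s ! i"] i
    by (simp add: nth_rotate add.commute)
  have "t ! j \<in> {(f ^^ k) x | k. True}" if "j < length t" for j
  proof -
    have "(length t - i + j + i) mod length t = j" using i that by simp
    then have "t ! j = (f ^^ (length t - i + j)) x" by (simp only: iter)
    then show ?thesis by blast
  qed
  moreover have "(f ^^ k) x \<in> set t" for k
    unfolding iter using i by (intro nth_mem mod_less_divisor) auto
  ultimately show ?thesis by (auto simp: in_set_conv_nth)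
qed

lemma is_cycle_unique:
  assumes "min_first s" "min_first t" "is_cycle f s" "is_cycle f t" "x \<in> set s" "x \<in> set t"
  shows "s = t"
proof -
  have sets: "set s = set t" using is_cycle_orbit assms(3-6) by metis
  have "length s = length t"
    using sets assms(1,2) distinct_card unfolding min_first_def by metis
  moreover have "u ! k = (f ^^ k) (Min (set u))"
    if "min_first u" "is_cycle f u" "k < length u" for u k
    using arg_cong[OF is_cycle_funpow[OF that(2), of k], of hd] that
    by (simp add: min_first_def hd_map hd_rotate_conv_nth)
  ultimately show ?thesis using assms(1-4) sets by (intro nth_equalityI) auto
qed

lemma is_cycle_rotate:
  assumes "is_cycle f t"
  shows "is_cycle f (rotate k t)"
  using assms unfolding is_cycle_def by (metis rotate_map rotate1_rotate_swap)

lemma is_cycle_cycle_of_list_comp: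
  assumes "p permutes I" "distinct cs" "set cs \<inter> I = {}"
  shows "is_cycle (cycle_of_list cs \<circ> p) cs"
    and "set t \<subseteq> I \<Longrightarrow> is_cycle p t \<Longrightarrow> is_cycle (cycle_of_list cs \<circ> p) t"
proof -
  have "is_cycle (cycle_of_list cs) cs"
    using cyclic_rotation[OF assms(2), of 1] by (simp add: is_cycle_def)
  moreover have "p x = x" if "x \<in> set cs" for x
    using that assms(3) permutes_not_in[OF assms(1)] by blast
  ultimately show "is_cycle (cycle_of_list cs \<circ> p) cs"
    using is_cycle_cong[of cs "cycle_of_list cs \<circ> p" "cycle_of_list cs"] by simp
next
  assume t: "set t \<subseteq> I" "is_cycle p t"
  have "cycle_of_list cs (p x) = p x" if "x \<in> set t" for x
    using that t(1) assms(3) permutes_in_image[OF assms(1)] by (intro id_outside_supp) blast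
  then show "is_cycle (cycle_of_list cs \<circ> p) t"
    using t(2) is_cycle_cong[of t "cycle_of_list cs \<circ> p" p] by simp
qed

lemma cycle_of_list_comp_permutes:
  assumes "p permutes I"
  shows "cycle_of_list cs \<circ> p permutes (set cs \<union> I)"
  by (rule permutes_compose[OF permutes_subset[OF assms] permutes_subset[OF cycle_permutes]]) auto

lemma cycle_decomp_permutes: "cycle_decomp I p \<Longrightarrow> p permutes I"
  by (induction rule: cycle_decomp.induct) (simp_all only: permutes_id cycle_of_list_comp_permutes)

lemma ex_rotate_min_first:
  assumes "distinct w" "w \<noteq> []"
  obtains k where "min_first (rotate k w)"
proof -
  have "Min (set w) \<in> set w" using assms by simp
  then obtain k where "k < length w" "w ! k = Min (set w)" by (auto simp: in_set_conv_nth)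
  then have "min_first (rotate k w)"
    using assms by (simp add: min_first_def hd_rotate_conv_nth)
  then show ?thesis by (rule that)
qed

lemma ex_cycle_word_partition:
  assumes "cycle_decomp I p"
  shows "\<exists>S. word_partition_on I S \<and> (\<forall>t\<in>S. is_cycle p t)"
  using assms
proof (induction rule: cycle_decomp.induct)
  case empty
  show ?case by (rule exI[of _ "{}"]) simp
next
  case (comp I p cs)
  then obtain S where S: "word_partition_on I S" "\<forall>t\<in>S. is_cycle p t" by blast
  note cyc = is_cycle_cycle_of_list_comp[OF cycle_decomp_permutes[OF comp.hyps(1)] comp.hyps(2,3)]
  have S_cyc: "\<forall>t\<in>S. is_cycle (cycle_of_list cs \<circ> p) t"
    using S cyc(2) word_partition_onD(4)[OF S(1)] by blast
  show ?case
  proof (cases "cs = []")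
    case True
    then show ?thesis using S(1) S_cyc by auto
  next
    case False
    then obtain k where k: "min_first (rotate k cs)" using ex_rotate_min_first comp.hyps(2) by blast
    have "word_partition_on (set cs \<union> I) (insert (rotate k cs) S)"
      using word_partition_on_insert(2)[OF k _ S(1)] comp.hyps(3) by simp
    moreover have "is_cycle (cycle_of_list cs \<circ> p) (rotate k cs)"
      by (rule is_cycle_rotate[OF cyc(1)])
    ultimately show ?thesis using S_cyc by blast
  qed
qed

lemma ex_permutation_with_cycles:
  assumes "word_partition_on A S"
  shows "\<exists>p. p permutes A \<and> (\<forall>t\<in>S. is_cycle p t)"
proof -
  have "finite S" using assms by (simp add: word_partition_on_def)
  then show ?thesis
    using assms
  proof (induction S arbitrary: A)
    case empty
    then show ?case by (auto intro: permutes_id)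
  next
    case (insert t S)
    note t = word_partition_onD[OF insert.prems insertI1]
    have S: "word_partition_on (A - set t) S"
      using word_partition_on_remove[OF insert.prems insertI1] insert.hyps(2) by simp
    then obtain p where p: "p permutes (A - set t)" "\<forall>t\<in>S. is_cycle p t" using insert.IH by blast
    note cyc = is_cycle_cycle_of_list_comp[OF p(1) t(3) Diff_disjoint]
    have "cycle_of_list t \<circ> p permutes A"
      using cycle_of_list_comp_permutes[OF p(1), of t] t(4) by (simp add: Un_absorb1)
    moreover have "\<forall>s\<in>insert t S. is_cycle (cycle_of_list t \<circ> p) s"
      using cyc p(2) word_partition_onD(4)[OF S] by blast
    ultimately show ?case by blast
  qed
qed

definition cycles_of :: "nat list \<Rightarrow> nat list set" where
  "cycles_of w = {t. min_first t \<and> set t \<subseteq> {1..length w} \<and> is_cycle (\<lambda>j. w ! (j - 1)) t}"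

lemma cycles_of_eqI:
  assumes S: "word_partition_on {1..length w} S" and cyc: "\<forall>t\<in>S. is_cycle (\<lambda>j. w ! (j - 1)) t"
  shows "cycles_of w = S"
proof
  show "S \<subseteq> cycles_of w"
    unfolding cycles_of_def using word_partition_onD(1,4)[OF S] cyc by blast
  show "cycles_of w \<subseteq> S"
  proof
    fix t assume t: "t \<in> cycles_of w"
    then have "hd t \<in> set t" "hd t \<in> {1..length w}"
      by (auto simp: cycles_of_def min_first_def dest: hd_in_set)
    then obtain s where "s \<in> S" "hd t \<in> set s"
      using S unfolding word_partition_on_def by blast
    then have "s = t"
      using is_cycle_unique[OF _ _ _ _ _ \<open>hd t \<in> set t\<close>] t cyc word_partition_onD(1)[OF S]
      by (auto simp: cycles_of_def)
    then show "t \<in> S" using \<open>s \<in> S\<close> by simp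
  qed
qed

lemma word_partition_on_cycles_of:
  assumes "w \<in> perms n"
  shows "word_partition_on {1..n} (cycles_of w)" "\<forall>t\<in>cycles_of w. is_cycle (\<lambda>j. w ! (j - 1)) t"
proof -
  let ?f = "\<lambda>j. w ! (j - 1)" and ?p = "\<lambda>j. if j \<in> {1..n} then w ! (j - 1) else j"
  have w: "distinct w" "length w = n" "set w = {1..n}"
    using assms length_perms by (auto simp: perms_def)
  have "bij_betw ?p {1..n} {1..n}"
    using bij_betw_nth_pred[OF w(1,2)] w(3) by (subst bij_betw_cong[of _ ?p ?f]) simp_all
  then have "?p permutes {1..n}" by (rule bij_imp_permutes) auto
  then obtain S where S: "word_partition_on {1..n} S" "\<forall>t\<in>S. is_cycle ?p t"
    using ex_cycle_word_partition[OF cycle_decomposition] by blast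
  have "is_cycle ?f t" if "t \<in> S" for t
    using S that word_partition_onD(4)[OF S(1) that] is_cycle_cong[of t ?p ?f]
    by (simp add: subset_iff)
  then have "cycles_of w = S" using S(1) w(2) by (intro cycles_of_eqI) simp_all
  then show "word_partition_on {1..n} (cycles_of w)" using S(1) by simp
  show "\<forall>t\<in>cycles_of w. is_cycle ?f t" by (simp add: cycles_of_def)
qed

lemma cycle_type_eq:
  assumes S: "word_partition_on {1..length w} S" and cyc: "\<forall>t\<in>S. is_cycle (\<lambda>j. w ! (j - 1)) t"
  shows "cycle_type w = image_mset length (mset_set S)"
proof -
  let ?orbit = "\<lambda>i. {((\<lambda>j. w ! (j - 1)) ^^ k) i |k. True}"
  have union: "(\<Union>t\<in>S. set t) = {1..length w}" using S by (simp add: word_partition_on_def)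
  have "?orbit ` set t = {set t}" if "t \<in> S" for t
    using is_cycle_orbit[OF cyc[rule_format, OF that]] word_partition_onD(2)[OF S that]
    by (auto simp: image_constant_conv cong: image_cong_simp)
  then have "(\<Union>t\<in>S. ?orbit ` set t) = set ` S" by auto
  then have orbits: "?orbit ` {1..length w} = set ` S"
    unfolding union[symmetric] by (simp only: image_UN)
  have "inj_on set S"
  proof (rule inj_onI)
    fix s t assume st: "s \<in> S" "t \<in> S" "set s = set t"
    have "hd s \<in> set s" using word_partition_onD(2)[OF S st(1)] by simp
    then show "s = t" using st by (intro word_partition_on_disjoint[OF S st(1,2)]) simp_all
  qed
  then have "mset_set (set ` S) = image_mset set (mset_set S)"
    by (rule image_mset_mset_set[symmetric])
  then have "cycle_type w = image_mset (\<lambda>t. card (set t)) (mset_set S)"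
    unfolding cycle_type_def orbits by (simp add: multiset.map_comp o_def)
  also have "\<dots> = image_mset length (mset_set S)"
    using word_partition_on_finite[OF S] word_partition_onD(3)[OF S]
    by (intro image_mset_cong) (simp add: distinct_card)
  finally show ?thesis .
qed

lemma cycles_of_inj_on: "inj_on cycles_of (perms n)"
proof (rule inj_onI)
  fix v w assume perms: "v \<in> perms n" "w \<in> perms n" "cycles_of v = cycles_of w"
  note cycles_v = word_partition_on_cycles_of[OF perms(1)]
    and cycles_w = word_partition_on_cycles_of[OF perms(2)]
  have "v ! i = w ! i" if "i < n" for i
  proof -
    have "Suc i \<in> (\<Union>t\<in>cycles_of v. set t)"
      using cycles_v(1) that by (auto simp: word_partition_on_def)
    then obtain t where t: "t \<in> cycles_of v" "Suc i \<in> set t" by blast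
    then have "map (\<lambda>j. v ! (j - 1)) t = map (\<lambda>j. w ! (j - 1)) t"
      using cycles_v(2) cycles_w(2) perms(3) by (simp add: is_cycle_def)
    then show ?thesis using t(2) by fastforce
  qed
  then show "v = w" using length_perms perms(1,2) by (intro nth_equalityI) auto
qed

theorem card_perms_cycle_type:
  "card {w \<in> perms n. cycle_type w = mset q} = card (word_partitions {1..n} q)"
proof (rule bij_betw_same_card, rule bij_betw_imageI)
  show "inj_on cycles_of {w \<in> perms n. cycle_type w = mset q}"
    by (rule inj_on_subset[OF cycles_of_inj_on]) auto
  have type: "cycle_type w = image_mset length (mset_set (cycles_of w))" if "w \<in> perms n" for w
    using word_partition_on_cycles_of[OF that] length_perms[OF that] by (intro cycle_type_eq) auto
  have "S \<in> cycles_of ` perms n" if S: "word_partition_on {1..n} S" for S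
  proof -
    obtain p where p: "p permutes {1..n}" "\<forall>t\<in>S. is_cycle p t"
      using ex_permutation_with_cycles[OF S] by blast
    let ?w = "map p [1..<n + 1]"
    have w: "?w \<in> perms n"
      using permutes_image[OF p(1)] permutes_inj_on[OF p(1)]
      by (simp add: perms_def distinct_map atLeastLessThanSuc_atLeastAtMost del: upt_Suc)
    have "?w ! (j - 1) = p j" if "j \<in> {1..n}" for j
      using that by (subst nth_map) (auto simp del: upt_Suc)
    then have "is_cycle (\<lambda>j. ?w ! (j - 1)) t" if "t \<in> S" for t
      using p(2) that word_partition_onD(4)[OF S that] is_cycle_cong[of t p "\<lambda>j. ?w ! (j - 1)"]
      by (metis subsetD)
    moreover have "length ?w = n" by (simp del: upt_Suc)
    ultimately have "cycles_of ?w = S" using S by (intro cycles_of_eqI ballI) (simp_all only:)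
    then show ?thesis using w by blast
  qed
  then have surj: "cycles_of ` perms n = {S. word_partition_on {1..n} S}"
    using word_partition_on_cycles_of(1) by (auto simp: image_subset_iff)
  have "cycles_of ` {w \<in> perms n. cycle_type w = mset q} =
    {S \<in> cycles_of ` perms n. image_mset length (mset_set S) = mset q}"
    by (auto simp: type)
  then show "cycles_of ` {w \<in> perms n. cycle_type w = mset q} = word_partitions {1..n} q"
    by (simp add: surj word_partitions_def)
qed

section \<open>The basis\<close>

text \<open>The key by which the words of a tuple in \<open>\<Gamma>(\<lambda>)\<close> are sorted.\<close>

definition block_key :: "nat list \<Rightarrow> int \<times> nat" where
  "block_key t = (- int (length t), hd t)"

lemma set_in_word_partitions_iff:
  assumes "distinct T"
  shows "set T \<in> word_partitions A q \<longleftrightarrow>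
    (\<forall>t\<in>set T. min_first t) \<and> distinct (concat T) \<and> set (concat T) = A \<and>
    mset (map length T) = mset q"
proof -
  have "removeAll [] T = T" if "\<forall>t\<in>set T. min_first t"
    using that by (intro removeAll_id) (auto simp: min_first_def)
  then have "distinct (concat T) \<longleftrightarrow> disjoint_family_on set (set T)" if "\<forall>t\<in>set T. min_first t"
    using that assms by (auto simp: distinct_concat_iff disjoint_family_on_def min_firstD)
  moreover have "image_mset length (mset_set (set T)) = mset (map length T)"
    using assms by (simp add: mset_set_set)
  ultimately show ?thesis
    by (auto simp: word_partitions_def word_partition_on_def)
qed

lemma map_length_eq_lam_iff:
  "map length T = lam q \<longleftrightarrow> mset (map length T) = mset q \<and>
    (\<forall>k. Suc k < length T \<longrightarrow> length (T ! Suc k) \<le> length (T ! k))"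
proof -
  have "map length T = lam q \<longleftrightarrow> rev (map length T) = sort q"
    by (simp only: lam_def rev_swap)
  also have "\<dots> \<longleftrightarrow> mset (rev (map length T)) = mset q \<and> sorted (rev (map length T))"
    by (metis mset_sort properties_for_sort sorted_sort)
  finally show ?thesis by (auto simp: sorted_rev_iff_nth_Suc)
qed

lemma sorted_block_key_iff:
  "sorted_wrt (<) (map block_key T) \<longleftrightarrow> (\<forall>k. Suc k < length T \<longrightarrow>
    length (T ! Suc k) \<le> length (T ! k) \<and>
    (length (T ! k) = length (T ! Suc k) \<longrightarrow> hd (T ! k) < hd (T ! Suc k)))"
proof -
  have "block_key s < block_key t \<longleftrightarrow>
    length t \<le> length s \<and> (length s = length t \<longrightarrow> hd s < hd t)" for s t
    by (auto simp: block_key_def less_prod_def)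
  then show ?thesis by (simp add: sorted_wrt_iff_nth_Suc_transp)
qed

lemma Gamma_iff:
  assumes "0 \<notin> set q"
  shows "T \<in> Gamma n (lam q) \<longleftrightarrow> set T \<in> word_partitions {1..n} q \<and> sorted_wrt (<) (map block_key T)"
proof
  assume T: "T \<in> Gamma n (lam q)"
  then have lens: "mset (map length T) = mset q"
    and sorted: "sorted_wrt (<) (map block_key T)"
    unfolding Gamma_def map_length_eq_lam_iff sorted_block_key_iff by auto
  have "[] \<notin> set T" using assms mset_eq_setD[OF lens] by force
  moreover have "distinct T"
    using sorted by (auto simp: strict_sorted_iff distinct_map)
  ultimately show "set T \<in> word_partitions {1..n} q \<and> sorted_wrt (<) (map block_key T)"
    using T lens sorted
    by (auto simp: set_in_word_partitions_iff Gamma_def min_first_def distinct_concat_iff)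
next
  assume T: "set T \<in> word_partitions {1..n} q \<and> sorted_wrt (<) (map block_key T)"
  then have "distinct T" by (auto simp: strict_sorted_iff distinct_map)
  then show "T \<in> Gamma n (lam q)"
    using T set_in_word_partitions_iff[of T "{1..n}" q]
    unfolding Gamma_def map_length_eq_lam_iff sorted_block_key_iff min_first_def by blast
qed

lemma word_partitions_inj_block_key:
  assumes "S \<in> word_partitions A q"
  shows "inj_on block_key S"
proof (rule inj_onI)
  fix s t assume in_S: "s \<in> S" "t \<in> S" and "block_key s = block_key t"
  then have same_hd: "hd s = hd t" by (simp add: block_key_def)
  have partition: "word_partition_on A S" using assms by (simp add: word_partitions_def)
  have "hd s \<in> set s" "hd t \<in> set t" using word_partition_onD(2)[OF partition] in_S by simp_all
  then show "s = t"
    using same_hd by (intro word_partition_on_disjoint[OF partition in_S, of "hd s"]) simp_all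
qed

lemma bij_betw_Gamma_word_partitions:
  assumes q: "0 \<notin> set q"
  shows "bij_betw set (Gamma n (lam q)) (word_partitions {1..n} q)"
proof (rule bij_betw_imageI)
  show "inj_on set (Gamma n (lam q))"
  proof (rule inj_onI)
    fix T U assume TU: "T \<in> Gamma n (lam q)" "U \<in> Gamma n (lam q)" and sets: "set T = set U"
    then have "set (map block_key T) = set (map block_key U)" by simp
    then have "map block_key T = map block_key U"
      using TU by (intro strict_sorted_equal[symmetric]) (simp_all only: Gamma_iff[OF q])
    moreover have "inj_on block_key (set T)"
      using TU(1) unfolding Gamma_iff[OF q] by (blast intro: word_partitions_inj_block_key)
    then have "inj_on block_key (set T \<union> set U)" by (simp add: sets)
    ultimately show "T = U" by (rule map_inj_on)
  qed
  show "set ` Gamma n (lam q) = word_partitions {1..n} q"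
  proof (intro set_eqI iffI)
    fix S assume S: "S \<in> word_partitions {1..n} q"
    then have "finite S" using word_partition_on_finite by (auto simp: word_partitions_def)
    then obtain xs where xs: "set xs = S" "distinct xs" using finite_distinct_list by blast
    let ?T = "sort_key block_key xs"
    have "distinct (map block_key ?T)"
      using xs word_partitions_inj_block_key[OF S] by (simp add: distinct_map)
    then have "sorted_wrt (<) (map block_key ?T)" by (simp add: strict_sorted_iff)
    then have "?T \<in> Gamma n (lam q)" using S xs by (simp add: Gamma_iff[OF q])
    then show "S \<in> set ` Gamma n (lam q)" using xs by (intro image_eqI[of _ _ ?T]) simp_all
  qed (auto simp: Gamma_iff[OF q])
qed

lemma conv_omega_q_left_normed_prod:
  assumes "n = sum_list q" "0 \<notin> set q" "concat us \<in> perms n" "[] \<notin> set us" "length us = length q"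
  shows "conv n (omega_q n q) (left_normed_prod us) =
    scl (of_nat (prod_list q)) (sym_prod q (set us))"
proof -
  have "distinct us"
    using assms(3,4) by (simp add: perms_def distinct_concat_iff removeAll_id)
  moreover have "conv n (omega_q n q) (left_normed_prod us) =
      lin_ext (dynkin_conv q) (left_normed_prod us)"
  proof -
    have "conv n (omega_q n q) (left_normed_prod us) =
        (\<Sum>w\<in>perms n. scl (left_normed_prod us w) (dynkin_conv q w))"
      unfolding conv_eq_sum by (intro sum.cong refl) (simp add: act_omega_q[OF _ assms(1)])
    also have "\<dots> = lin_ext (dynkin_conv q) (left_normed_prod us)"
      using left_normed_prod_in_group_alg[OF assms(3)]
      by (intro lin_ext_superset[symmetric]) (auto simp: group_alg_def)
    finally show ?thesis .
  qed
  ultimately show ?thesis using assms by (simp add: lin_ext_dynkin_conv)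
qed

lemma conv_omega_q_QT:
  assumes "n = sum_list q" "0 \<notin> set q" "T \<in> Gamma n (lam q)"
  shows "conv n (omega_q n q) (QT T) = scl (of_nat (prod_list q)) (sym_prod q (set T))"
proof -
  have T: "set T \<in> word_partitions {1..n} q" "distinct T"
    using assms(3) by (auto simp: Gamma_iff[OF assms(2)] strict_sorted_iff distinct_map)
  have "map length T = lam q" using assms(3) by (simp add: Gamma_def)
  then have "length T = length q" by (metis lam_def length_map length_rev length_sort)
  then show ?thesis
    unfolding QT_eq_left_normed_prod using T
    by (intro conv_omega_q_left_normed_prod assms)
      (auto simp: set_in_word_partitions_iff perms_def min_first_def)
qed

lemma sym_prod_mem_Lie:
  assumes "n = sum_list q" "0 \<notin> set q" "(of_nat (prod_list q) :: 'a::field) \<noteq> 0"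
    and "S \<in> word_partitions {1..n} q"
  shows "(sym_prod q S :: 'a comb) \<in> Lie n q"
proof -
  obtain T where T: "T \<in> Gamma n (lam q)" "S = set T"
    using bij_betw_imp_surj_on[OF bij_betw_Gamma_word_partitions[OF assms(2)]] assms(4) by blast
  have "concat T \<in> perms n" using T(1) by (simp add: Gamma_def perms_def)
  then have "conv n (omega_q n q) (QT T :: 'a comb) \<in> Lie n q"
    using left_normed_prod_in_group_alg unfolding Lie_def QT_eq_left_normed_prod by blast
  then have "scl (inverse (of_nat (prod_list q))) (scl (of_nat (prod_list q)) (sym_prod q S)) \<in>
      (Lie n q :: 'a comb set)"
    unfolding conv_omega_q_QT[OF assms(1,2) T(1)] T(2)[symmetric] Lie_eq_span[OF assms(1)]
    by (rule comb.span_scale)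
  then show ?thesis using assms(3) by simp
qed

lemma conv_omega_q_min_first_in_span:
  assumes "n = sum_list q" "0 \<notin> set q" "concat vs \<in> perms n" "map length vs = q"
    and "\<forall>v\<in>set vs. min_first v"
  shows "(conv n (omega_q n q) (left_normed_prod vs) :: 'a::field comb) \<in>
    comb.span (sym_prod q ` word_partitions {1..n} q)"
proof -
  have nonempty: "[] \<notin> set vs" using assms(5) min_firstD(1) by blast
  then have "distinct vs" using assms(3) by (simp add: perms_def distinct_concat_iff removeAll_id)
  then have "set vs \<in> word_partitions {1..n} q"
    using assms by (simp add: set_in_word_partitions_iff perms_def)
  moreover have "conv n (omega_q n q) (left_normed_prod vs) =
      (scl (of_nat (prod_list q)) (sym_prod q (set vs)) :: 'a comb)"
    using assms nonempty by (intro conv_omega_q_left_normed_prod) auto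
  ultimately show ?thesis by (simp add: comb.span_scale comb.span_base)
qed

lemma sym_prod_unshuffle_in_span:
  assumes n: "n = sum_list q" and q: "0 \<notin> set q"
    and prod_nonzero: "(of_nat (prod_list q) :: 'a::field) \<noteq> 0"
    and w: "w \<in> perms n" and us: "us \<in> unshuffles q w"
  shows "(sym_prod q (set us) :: 'a comb) \<in> comb.span (sym_prod q ` word_partitions {1..n} q)"
proof -
  let ?U = "comb.span (sym_prod q ` word_partitions {1..n} q) :: 'a comb set"
  let ?B = "{left_normed_prod vs :: 'a comb | vs.
    (\<forall>v\<in>set vs. min_first v) \<and> map mset vs = map mset us}"
  let ?\<omega> = "omega_q n q :: 'a comb"
  have distinct_w: "distinct w" using w by (simp add: perms_def)
  have us_perms: "concat us \<in> perms n" and lengths: "map length us = q"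
    using us w perms_cong_mset[of "concat us" w] by (auto simp: unshuffles_def)
  have "conv n ?\<omega> (left_normed_prod vs) \<in> ?U"
    if vs: "\<forall>v\<in>set vs. min_first v" "map mset vs = map mset us" for vs
  proof (rule conv_omega_q_min_first_in_span[OF n q _ _ vs(1)])
    have "mset (concat vs) = mset (concat us)" using vs(2) by (simp add: mset_concat)
    then show "concat vs \<in> perms n" using us_perms perms_cong_mset by blast
    have "map length vs = map length us"
      using arg_cong[OF vs(2), of "map size"] by (simp add: o_def)
    then show "map length vs = q" using lengths by simp
  qed
  then have "comb.span (conv n ?\<omega> ` ?B) \<subseteq> ?U"
    by (intro comb.span_minimal comb.subspace_span) blast
  moreover have "left_normed_prod us \<in> comb.span ?B"
    using unshuffles_distinct[OF us distinct_w q]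
    by (intro left_normed_prod_in_span_min_first) (auto simp: distinct_concat_iff)
  ultimately have "conv n ?\<omega> (left_normed_prod us) \<in> ?U"
    by (auto simp: module_hom.span_image[OF comb_linear_conv])
  moreover have "conv n ?\<omega> (left_normed_prod us) = scl (of_nat (prod_list q)) (sym_prod q (set us))"
    using us_perms lengths unshuffles_distinct(2)[OF us distinct_w q]
    by (intro conv_omega_q_left_normed_prod[OF n q]) auto
  ultimately have
    "scl (inverse (of_nat (prod_list q))) (scl (of_nat (prod_list q)) (sym_prod q (set us))) \<in> ?U"
    by (simp only: comb.span_scale)
  then show ?thesis using prod_nonzero by simp
qed

theorem Lie_eq_span_sym_prod:
  assumes "n = sum_list q" "0 \<notin> set q" "(of_nat (prod_list q) :: 'a::field) \<noteq> 0"
  shows "(Lie n q :: 'a comb set) = comb.span (sym_prod q ` word_partitions {1..n} q)"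
proof
  have "dynkin_conv q w \<in> comb.span (sym_prod q ` word_partitions {1..n} q :: 'a comb set)"
    if "w \<in> perms n" for w
    using that assms sym_prod_unshuffle_in_span[OF assms that]
    by (auto simp: dynkin_conv_eq_sum_sym_prod perms_def intro!: comb.span_sum)
  then show "Lie n q \<subseteq> comb.span (sym_prod q ` word_partitions {1..n} q :: 'a comb set)"
    unfolding Lie_eq_span[OF assms(1)] by (intro comb.span_minimal comb.subspace_span) blast
  have "sym_prod q ` word_partitions {1..n} q \<subseteq> (Lie n q :: 'a comb set)"
    using sym_prod_mem_Lie[OF assms] by blast
  then show "comb.span (sym_prod q ` word_partitions {1..n} q) \<subseteq> (Lie n q :: 'a comb set)"
    unfolding Lie_eq_span[OF assms(1)] by (intro comb.span_minimal comb.subspace_span)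
qed

lemma exists_map_eq_if_image_mset_eq:
  assumes "image_mset f M = mset ys"
  shows "\<exists>xs. mset xs = M \<and> map f xs = ys"
  using assms
proof (induction ys arbitrary: M)
  case (Cons y ys)
  then obtain x N where "M = add_mset x N" "f x = y" "image_mset f N = mset ys"
    by (metis msed_map_invR mset.simps(2))
  then show ?case using Cons.IH[of N] by (metis list.simps(9) mset.simps(2))
qed simp

lemma sym_prod_dual_word:
  assumes S: "S \<in> word_partitions A q"
  obtains z where "\<And>S'. S' \<in> word_partitions A q \<Longrightarrow> sym_prod q S' z =
      (if S' = S then 1 else 0 :: 'a::field)"
proof -
  have part: "word_partition_on A S" "image_mset length (mset_set S) = mset q"
    using S by (auto simp: word_partitions_def)
  then obtain ts where ts: "mset ts = mset_set S" "map length ts = q"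
    using exists_map_eq_if_image_mset_eq by blast
  have set_ts: "set ts = S" "distinct ts"
    using ts(1) word_partition_on_finite[OF part(1)]
    by (metis finite_set_mset_mset_set set_mset_mset, metis mset_eq_mset_set_imp_distinct)
  have "sym_prod q S' (concat ts) = (if S' = S then 1 else 0 :: 'a)"
    if "S' \<in> word_partitions A q" for S'
  proof -
    have S': "word_partition_on A S'" using that by (simp add: word_partitions_def)
    have "sym_prod q S' (concat ts) = (if ts \<in> permutations_of_set S' then 1 else 0 :: 'a)"
      using word_partition_on_finite[OF S'] word_partition_onD(1)[OF S']
        word_partition_onD(1)[OF part(1)]
      by (intro sym_prod_min_first_apply) (auto simp: ts(2) set_ts(1))
    then show ?thesis using set_ts by (auto simp: permutations_of_set_def)
  qed
  then show ?thesis by (rule that)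
qed

lemma independent_if_dual_coordinates:
  fixes F :: "'b \<Rightarrow> 'a::field comb"
  assumes "\<And>i. i \<in> I \<Longrightarrow> \<exists>z. F i z \<noteq> 0 \<and> (\<forall>j\<in>I. j \<noteq> i \<longrightarrow> F j z = 0)"
  shows "inj_on F I" "comb.independent (F ` I)"
proof -
  show "inj_on F I" using assms by (metis inj_onI)
  show "comb.independent (F ` I)"
    unfolding comb.independent_explicit_module
  proof (intro allI impI)
    fix V u v assume V: "finite V" "V \<subseteq> F ` I" "(\<Sum>x\<in>V. scl (u x) x) = 0" "v \<in> V"
    obtain i z where i: "i \<in> I" "v = F i" "F i z \<noteq> 0" "\<forall>j\<in>I. j \<noteq> i \<longrightarrow> F j z = 0"
      using assms V(2,4) by blast
    have "0 = (\<Sum>x\<in>V. scl (u x) x) z" using V(3) by simp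
    also have "\<dots> = (\<Sum>x\<in>V. u x * x z)" by (simp add: sum_comb_apply)
    also have "\<dots> = (\<Sum>x\<in>{v}. u x * x z)"
      by (rule sum.mono_neutral_right) (use V i in auto)
    finally show "u v = 0" using i by simp
  qed
qed

lemma independent_scaled_sym_prod:
  assumes "(c :: 'a::field) \<noteq> 0"
  shows "inj_on (\<lambda>S. scl c (sym_prod q S)) (word_partitions A q)"
    and "comb.independent ((\<lambda>S. scl c (sym_prod q S)) ` word_partitions A q)"
proof -
  have "\<exists>z. scl c (sym_prod q S) z \<noteq> 0 \<and>
      (\<forall>S'\<in>word_partitions A q. S' \<noteq> S \<longrightarrow> scl c (sym_prod q S') z = 0)"
    if S: "S \<in> word_partitions A q" for S
  proof -
    obtain z where "\<And>S'. S' \<in> word_partitions A q \<Longrightarrow> sym_prod q S' z =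
        (if S' = S then 1 else 0 :: 'a)"
      using sym_prod_dual_word[OF S] by blast
    then show ?thesis using S assms by (intro exI[of _ z]) simp
  qed
  note dual = independent_if_dual_coordinates[of "word_partitions A q", OF this]
  show "inj_on (\<lambda>S. scl c (sym_prod q S)) (word_partitions A q)" by (rule dual(1))
  show "comb.independent ((\<lambda>S. scl c (sym_prod q S)) ` word_partitions A q)" by (rule dual(2))
qed

lemma span_scaled_sym_prod:
  assumes "(c :: 'a::field) \<noteq> 0" "finite A"
  shows "comb.span ((\<lambda>S. scl c (sym_prod q S)) ` word_partitions A q) =
    comb.span (sym_prod q ` word_partitions A q)"
  using comb.span_image_scale[of "sym_prod q ` word_partitions A q" "\<lambda>_. c"] assms
  by (simp add: image_image finite_word_partitions)

lemma of_nat_prod_list_neq_0: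
  "\<forall>i\<in>set q. \<not> CHAR('a::field) dvd i \<Longrightarrow> (of_nat (prod_list q) :: 'a) \<noteq> 0"
  by (induction q) (auto simp: of_nat_eq_0_iff_char_dvd)

theorem mainTheorem4:
  fixes n :: nat and q :: "nat list"
  assumes "composition n q"
    and "\<forall>i\<in>set q. \<not> CHAR('a::field) dvd i"
  shows "inj_on (\<lambda>T. conv n (omega_q n q) (QT T) :: 'a comb) (Gamma n (lam q))
    \<and> \<not> module.dependent (scl :: 'a \<Rightarrow> 'a comb \<Rightarrow> 'a comb)
          ((\<lambda>T. conv n (omega_q n q) (QT T)) ` Gamma n (lam q))
    \<and> module.span (scl :: 'a \<Rightarrow> 'a comb \<Rightarrow> 'a comb)
          ((\<lambda>T. conv n (omega_q n q) (QT T)) ` Gamma n (lam q)) = Lie n q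
    \<and> vector_space.dim (scl :: 'a \<Rightarrow> 'a comb \<Rightarrow> 'a comb) (Lie n q :: 'a comb set)
        = fact n div qq q
    \<and> card {w \<in> perms n. cycle_type w = mset (lam q)} = fact n div qq q"
proof -
  have n: "n = sum_list q" and q: "0 \<notin> set q" using assms(1) by (auto simp: composition_def)
  define c :: 'a where "c = of_nat (prod_list q)"
  have c_nonzero: "c \<noteq> 0" unfolding c_def by (rule of_nat_prod_list_neq_0[OF assms(2)])
  let ?G = "Gamma n (lam q)" and ?W = "word_partitions {1..n} q"
  let ?F = "\<lambda>T. conv n (omega_q n q) (QT T) :: 'a comb" and ?P = "\<lambda>S. scl c (sym_prod q S)"
  have F_eq: "?F T = ?P (set T)" if "T \<in> ?G" for T
    unfolding c_def by (rule conv_omega_q_QT[OF n q that])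
  note bij = bij_betw_Gamma_word_partitions[OF q, of n]
    and basis = independent_scaled_sym_prod[OF c_nonzero, where q = q and A = "{1..n}"]
  have F_image: "?F ` ?G = ?P ` ?W"
    unfolding bij_betw_imp_surj_on[OF bij, symmetric] image_image by (rule image_cong[OF refl F_eq])
  have "inj_on (?P \<circ> set) ?G"
    using basis(1) bij unfolding bij_betw_def by (metis comp_inj_on)
  then have inj: "inj_on ?F ?G"
    by (subst inj_on_cong[of _ ?F "?P \<circ> set"]) (simp_all only: F_eq o_apply)
  have span: "comb.span (?P ` ?W) = Lie n q"
    by (simp only: span_scaled_sym_prod[OF c_nonzero finite_atLeastAtMost]
        Lie_eq_span_sym_prod[OF n q c_nonzero[unfolded c_def]])
  have card: "card ?W = fact n div qq q"
    by (subst card_word_partitions) (simp_all add: q flip: n)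
  have "comb.dim (Lie n q :: 'a comb set) = fact n div qq q"
    using comb.dim_span_eq_card_independent[OF basis(2)]
    by (simp only: span card_image[OF basis(1)] card)
  moreover have "mset (lam q) = mset q" by (simp add: lam_def)
  ultimately show ?thesis
    unfolding F_image using inj basis(2) span by (simp only: card_perms_cycle_type card simp_thms)
qed

end
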